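(* Let $G$ be a group equipped with a conjugation-invariant norm and let $T$ be a scaling set. For any $T$-valued scaling sequence $\mathbf{d}$ and any non-principal ultrafilter $\omega$ on $\mathbb{N}$ there is a well-defined canonical homomorphism $$\rho_{\omega,\mathbf{d}}\colon\hat{\mathcal{C}}(G,T)\to\mathrm{Cone}_\omega(G,\mathbf{d}),\qquad[g]\mapsto\{g\circ\mathbf{d}\}.$$ It is Lipschitz with constant $1$.
   Context: Norms. A norm on a group $G$ is a function $\|\cdot\|\colon G\to[0,\infty)$ with $\|g\|=0\iff g=1$, $\|g^{-1}\|=\|g\|$ and $\|gh\|\le\|g\|+\|h\|$; for a pseudonorm one only requires $\|1\|=0$ instead of the first condition. It is conjugation-invariant if $\|hgh^{-1}\|=\|g\|$ for all $g,h$. It induces the bi-invariant (pseudo)metric $d(g,h)=\|g^{-1}h\|$; all metric notions refer to it. A homomorphism $\varphi$ is Lipschitz with constant $C$ iff $\|\varphi(g)\|\le C\|g\|$ for all $g$. The groups $F_{\mathbb{R}}(G)$ and $F(G)$. $F_{\mathbb{R}}(G)$ is the free product of copies of the additive group $\mathbb{R}$ indexed by the elements $g$ of the set $G$; the element $r$ of the copy indexed by $g$ is written $\overline{g}(r)$. It carries the conjugation-invariant pseudonorm $$\|x\|=\inf\Big\{\sum_{i=1}^n |r_i|\,\|g_i\| : x=\prod_{i=1}^n h_i\,\overline{g_i}(r_i)^{\pm1}h_i^{-1},\ h_i\in F_{\mathbb{R}}(G)\Big\}.$$ $F(G)\le F_{\mathbb{R}}(G)$ is the subgroup generated by the elements $\overline{g}:=\overline{g}(1)$;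 it is free on $\{\overline{g}: g\in G\}$. For $t\in\mathbb{R}$, $\psi_t\colon F_{\mathbb{R}}(G)\to F_{\mathbb{R}}(G)$ is the homomorphism with $\psi_t(\overline{g}(r))=\overline{g}(tr)$. $\pi\colon F(G)\to G$ is the homomorphism with $\pi(\overline{g})=g$. Directional asymptotic cone. A scaling set is an unbounded subset $T\subseteq(0,\infty)$; limits over $t\in T$ are taken as $t\to\infty$. A function $f$ from $T$ to a pseudometric space is Cauchy if for every $\epsilon>0$, $d(f(t),f(t'))<\epsilon$ for all sufficiently large $t,t'\in T$. $\mathcal{D}(G,T)$ is the group (pointwise product) of all functions $w\colon T\to F(G)$ such that $t\mapsto\psi_{1/t}(w(t))\in F_{\mathbb{R}}(G)$ is Cauchy, with pseudonorm $\|w\|=\lim_{t\in T}\|\psi_{1/t}(w(t))\|$. $\mathcal{C}(G,T)=\{\pi\circ w: w\in\mathcal{D}(G,T)\}$, a group of functions $T\to G$, with pseudonorm $\|g\|=\inf\{\|w\|: w\in\mathcal{D}(G,T),\ \pi\circ w=g\}$. The directional asymptotic cone $\hat{\mathcal{C}}(G,T)$ is the quotient of $\mathcal{C}(G,T)$ by the normal subgroup of elements of pseudonorm $0$, with the induced conjugation-invariant norm; $[g]$ denotes the class of $g$. Ultrafilter cone. A $T$-valued scaling sequence is a function $\mathbf{d}\colon\mathbb{N}\to T$, $n\mapsto d_n$, with $\lim_{n\to\infty}d_n=\infty$. For a non-principal ultrafilter $\omega$ on $\mathbb{N}$, $\mathrm{Cone}_\omega(G,\mathbf{d})$ is the group of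 sequences $(g_n)$ in $G$ with $\limsup_n\|g_n\|/d_n<\infty$ (pointwise product), modulo $(g_n)\sim(h_n)\iff\omega\text{-}\lim_n\|g_n^{-1}h_n\|/d_n=0$, with the norm $\|\{g_n\}\|=\omega\text{-}\lim_n\|g_n\|/d_n$; $\{g_n\}$ denotes the class of $(g_n)$, and $\{g\circ\mathbf{d}\}=\{g(d_n)\}_n$. *)

theory Defs
  imports "HOL-Analysis.Analysis" "HOL-Algebra.Product_Groups" "HOL-Algebra.Generated_Groups"
begin

section \<open>Norms on groups\<close>

locale conj_inv_normed_group = group G for G (structure) +
  fixes N :: "'a \<Rightarrow> real"
  assumes norm_nonneg: "x \<in> carrier G \<Longrightarrow> 0 \<le> N x"
    and norm_eq_0_iff: "x \<in> carrier G \<Longrightarrow> N x = 0 \<longleftrightarrow> x = \<one>"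
    and norm_inv: "x \<in> carrier G \<Longrightarrow> N (inv x) = N x"
    and norm_triangle: "\<lbrakk>x \<in> carrier G; y \<in> carrier G\<rbrakk> \<Longrightarrow> N (x \<otimes> y) \<le> N x + N y"
    and norm_conj: "\<lbrakk>x \<in> carrier G; h \<in> carrier G\<rbrakk> \<Longrightarrow> N (h \<otimes> x \<otimes> inv h) = N x"

definition norm_dist :: "('a, 'm) monoid_scheme \<Rightarrow> ('a \<Rightarrow> real) \<Rightarrow> 'a \<Rightarrow> 'a \<Rightarrow> real"
  where "norm_dist G N x y = N (inv\<^bsub>G\<^esub> x \<otimes>\<^bsub>G\<^esub> y)"

definition lipschitz_map ::
    "real \<Rightarrow> ('a, 'm) monoid_scheme \<Rightarrow> ('a \<Rightarrow> real) \<Rightarrow> ('b, 'n) monoid_scheme \<Rightarrow> ('b \<Rightarrow> real)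
      \<Rightarrow> ('a \<Rightarrow> 'b) \<Rightarrow> bool"
  where "lipschitz_map C A NA B NB \<phi> \<longleftrightarrow>
    (\<forall>x\<in>carrier A. \<forall>y\<in>carrier A. norm_dist B NB (\<phi> x) (\<phi> y) \<le> C * norm_dist A NA x y)"

text \<open>Quotient of a monoid by a congruence; the product of two classes is the class of the
  product of any two representatives.\<close>

definition quotient_monoid :: "('a, 'm) monoid_scheme \<Rightarrow> ('a \<times> 'a) set \<Rightarrow> 'a set monoid"
  where "quotient_monoid M r =
    \<lparr>carrier = carrier M // r,
     mult = (\<lambda>X Y. \<Union>x\<in>X. \<Union>y\<in>Y. r `` {x \<otimes>\<^bsub>M\<^esub> y}),
     one = r `` {\<one>\<^bsub>M\<^esub>}\<rparr>"


section \<open>Free products\<close>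

definition free_product_words :: "'i set \<Rightarrow> ('i \<Rightarrow> ('a, 'm) monoid_scheme) \<Rightarrow> ('i \<times> 'a) list monoid"
  where "free_product_words I A =
    \<lparr>carrier = lists (SIGMA i:I. carrier (A i)), mult = (@), one = []\<rparr>"

inductive_set free_product_rel ::
    "'i set \<Rightarrow> ('i \<Rightarrow> ('a, 'm) monoid_scheme) \<Rightarrow> (('i \<times> 'a) list \<times> ('i \<times> 'a) list) set"
  for I :: "'i set" and A :: "'i \<Rightarrow> ('a, 'm) monoid_scheme"
  where
    refl: "u \<in> carrier (free_product_words I A) \<Longrightarrow> (u, u) \<in> free_product_rel I A"
  | sym: "(u, v) \<in> free_product_rel I A \<Longrightarrow> (v, u) \<in> free_product_rel I A"
  | trans: "\<lbrakk>(u, v) \<in> free_product_rel I A; (v, w) \<in> free_product_rel I A\<rbrakk>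
      \<Longrightarrow> (u, w) \<in> free_product_rel I A"
  | one: "\<lbrakk>u \<in> carrier (free_product_words I A); v \<in> carrier (free_product_words I A); i \<in> I\<rbrakk>
      \<Longrightarrow> (u @ [(i, \<one>\<^bsub>A i\<^esub>)] @ v, u @ v) \<in> free_product_rel I A"
  | mult: "\<lbrakk>u \<in> carrier (free_product_words I A); v \<in> carrier (free_product_words I A); i \<in> I;
      a \<in> carrier (A i); b \<in> carrier (A i)\<rbrakk>
      \<Longrightarrow> (u @ [(i, a), (i, b)] @ v, u @ [(i, a \<otimes>\<^bsub>A i\<^esub> b)] @ v) \<in> free_product_rel I A"

definition free_product :: "'i set \<Rightarrow> ('i \<Rightarrow> ('a, 'm) monoid_scheme) \<Rightarrow> ('i \<times> 'a) list set monoid"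
  where "free_product I A = quotient_monoid (free_product_words I A) (free_product_rel I A)"

definition free_product_incl ::
    "'i set \<Rightarrow> ('i \<Rightarrow> ('a, 'm) monoid_scheme) \<Rightarrow> 'i \<Rightarrow> 'a \<Rightarrow> ('i \<times> 'a) list set"
  where "free_product_incl I A i a = free_product_rel I A `` {[(i, a)]}"


section \<open>The groups $F_{\mathbb{R}}(G)$ and $F(G)$\<close>

definition real_group :: "real monoid"
  where "real_group = \<lparr>carrier = UNIV, monoid.mult = (+), one = 0\<rparr>"

definition FR :: "('a, 'm) monoid_scheme \<Rightarrow> ('a \<times> real) list set monoid"
  where "FR G = free_product (carrier G) (\<lambda>_. real_group)"

definition gen :: "('a, 'm) monoid_scheme \<Rightarrow> 'a \<Rightarrow> real \<Rightarrow> ('a \<times> real) list set"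
  where "gen G g r = free_product_incl (carrier G) (\<lambda>_. real_group) g r"

text \<open>An entry \<open>(h, g, r, e)\<close> of the list stands for the factor
  $h\,\overline{g}(r)^{e}\,h^{-1}$.\<close>

definition conj_prod ::
    "('a, 'm) monoid_scheme \<Rightarrow> (('a \<times> real) list set \<times> 'a \<times> real \<times> int) list \<Rightarrow> ('a \<times> real) list set"
  where "conj_prod G cs =
    foldr (\<lambda>(h, g, r, e) x. (h \<otimes>\<^bsub>FR G\<^esub> (gen G g r [^]\<^bsub>FR G\<^esub> e) \<otimes>\<^bsub>FR G\<^esub> inv\<^bsub>FR G\<^esub> h) \<otimes>\<^bsub>FR G\<^esub> x)
      cs \<one>\<^bsub>FR G\<^esub>"

definition FR_norm :: "('a, 'm) monoid_scheme \<Rightarrow> ('a \<Rightarrow> real) \<Rightarrow> ('a \<times> real) list set \<Rightarrow> real"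
  where "FR_norm G N x =
    Inf {(\<Sum>(h, g, r, e)\<leftarrow>cs. \<bar>r\<bar> * N g) | cs.
      set cs \<subseteq> carrier (FR G) \<times> carrier G \<times> UNIV \<times> {1, -1} \<and> x = conj_prod G cs}"

definition FZ :: "('a, 'm) monoid_scheme \<Rightarrow> ('a \<times> real) list set monoid"
  where "FZ G = subgroup_generated (FR G) ((\<lambda>g. gen G g 1) ` carrier G)"

definition scale_hom ::
    "('a, 'm) monoid_scheme \<Rightarrow> real \<Rightarrow> ('a \<times> real) list set \<Rightarrow> ('a \<times> real) list set"
  where "scale_hom G t = (THE \<phi>. \<phi> \<in> hom (FR G) (FR G) \<and> \<phi> \<in> extensional (carrier (FR G)) \<and>
    (\<forall>g\<in>carrier G. \<forall>r. \<phi> (gen G g r) = gen G g (t * r)))"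

definition eval_hom :: "('a, 'm) monoid_scheme \<Rightarrow> ('a \<times> real) list set \<Rightarrow> 'a"
  where "eval_hom G = (THE \<phi>. \<phi> \<in> hom (FZ G) G \<and> \<phi> \<in> extensional (carrier (FZ G)) \<and>
    (\<forall>g\<in>carrier G. \<phi> (gen G g 1) = g))"


section \<open>The directional asymptotic cone\<close>

definition scaling_set :: "real set \<Rightarrow> bool"
  where "scaling_set T \<longleftrightarrow> T \<subseteq> {0<..} \<and> \<not> bounded T"

definition at_top_in :: "real set \<Rightarrow> real filter"
  where "at_top_in T = inf at_top (principal T)"

definition cauchy_on :: "real set \<Rightarrow> ('b \<Rightarrow> 'b \<Rightarrow> real) \<Rightarrow> (real \<Rightarrow> 'b) \<Rightarrow> bool"
  where "cauchy_on T D f \<longleftrightarrow>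
    (\<forall>\<epsilon>>0. \<exists>s. \<forall>t\<in>T. \<forall>t'\<in>T. t \<ge> s \<longrightarrow> t' \<ge> s \<longrightarrow> D (f t) (f t') < \<epsilon>)"

text \<open>Functions on \<open>T\<close> are elements of \<^const>\<open>product_group\<close>, hence
  \<^const>\<open>undefined\<close> outside \<open>T\<close>.\<close>

definition dir_group ::
    "('a, 'm) monoid_scheme \<Rightarrow> ('a \<Rightarrow> real) \<Rightarrow> real set \<Rightarrow> (real \<Rightarrow> ('a \<times> real) list set) monoid"
  where "dir_group G N T = (product_group T (\<lambda>_. FZ G))
    \<lparr>carrier := {w \<in> carrier (product_group T (\<lambda>_. FZ G)).
      cauchy_on T (norm_dist (FR G) (FR_norm G N)) (\<lambda>t. scale_hom G (1 / t) (w t))}\<rparr>"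

definition dir_norm ::
    "('a, 'm) monoid_scheme \<Rightarrow> ('a \<Rightarrow> real) \<Rightarrow> real set \<Rightarrow> (real \<Rightarrow> ('a \<times> real) list set) \<Rightarrow> real"
  where "dir_norm G N T w = Lim (at_top_in T) (\<lambda>t. FR_norm G N (scale_hom G (1 / t) (w t)))"

definition pre_cone :: "('a, 'm) monoid_scheme \<Rightarrow> ('a \<Rightarrow> real) \<Rightarrow> real set \<Rightarrow> (real \<Rightarrow> 'a) monoid"
  where "pre_cone G N T = (product_group T (\<lambda>_. G))
    \<lparr>carrier := (\<lambda>w. compose T (eval_hom G) w) ` carrier (dir_group G N T)\<rparr>"

definition pre_cone_norm ::
    "('a, 'm) monoid_scheme \<Rightarrow> ('a \<Rightarrow> real) \<Rightarrow> real set \<Rightarrow> (real \<Rightarrow> 'a) \<Rightarrow> real"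
  where "pre_cone_norm G N T g =
    Inf {dir_norm G N T w | w. w \<in> carrier (dir_group G N T) \<and> compose T (eval_hom G) w = g}"

definition pre_cone_null ::
    "('a, 'm) monoid_scheme \<Rightarrow> ('a \<Rightarrow> real) \<Rightarrow> real set \<Rightarrow> (real \<Rightarrow> 'a) set"
  where "pre_cone_null G N T = {g \<in> carrier (pre_cone G N T). pre_cone_norm G N T g = 0}"

definition dir_cone :: "('a, 'm) monoid_scheme \<Rightarrow> ('a \<Rightarrow> real) \<Rightarrow> real set \<Rightarrow> (real \<Rightarrow> 'a) set monoid"
  where "dir_cone G N T = pre_cone G N T Mod pre_cone_null G N T"

definition dir_cone_class ::
    "('a, 'm) monoid_scheme \<Rightarrow> ('a \<Rightarrow> real) \<Rightarrow> real set \<Rightarrow> (real \<Rightarrow> 'a) \<Rightarrow> (real \<Rightarrow> 'a) set"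
  where "dir_cone_class G N T g = pre_cone_null G N T #>\<^bsub>pre_cone G N T\<^esub> g"

text \<open>The induced norm is the common value of the pseudonorm on a class.\<close>

definition dir_cone_norm ::
    "('a, 'm) monoid_scheme \<Rightarrow> ('a \<Rightarrow> real) \<Rightarrow> real set \<Rightarrow> (real \<Rightarrow> 'a) set \<Rightarrow> real"
  where "dir_cone_norm G N T X = the_elem (pre_cone_norm G N T ` X)"


section \<open>The ultrafilter cone\<close>

definition nonprincipal_ultrafilter :: "'a filter \<Rightarrow> bool"
  where "nonprincipal_ultrafilter \<omega> \<longleftrightarrow>
    \<omega> \<noteq> bot \<and> (\<forall>P. eventually P \<omega> \<or> eventually (\<lambda>x. \<not> P x) \<omega>) \<and> (\<forall>x. \<omega> \<noteq> principal {x})"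

definition scaling_sequence :: "real set \<Rightarrow> (nat \<Rightarrow> real) \<Rightarrow> bool"
  where "scaling_sequence T d \<longleftrightarrow> range d \<subseteq> T \<and> filterlim d at_top sequentially"

definition bounded_seq_group ::
    "('a, 'm) monoid_scheme \<Rightarrow> ('a \<Rightarrow> real) \<Rightarrow> (nat \<Rightarrow> real) \<Rightarrow> (nat \<Rightarrow> 'a) monoid"
  where "bounded_seq_group G N d = (product_group UNIV (\<lambda>_. G))
    \<lparr>carrier := {g \<in> carrier (product_group UNIV (\<lambda>_. G)).
      limsup (\<lambda>n. ereal (N (g n) / d n)) < \<infinity>}\<rparr>"

definition ultra_cone_rel ::
    "('a, 'm) monoid_scheme \<Rightarrow> ('a \<Rightarrow> real) \<Rightarrow> (nat \<Rightarrow> real) \<Rightarrow> nat filter \<Rightarrow> ((nat \<Rightarrow> 'a) \<times> (nat \<Rightarrow> 'a)) set"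
  where "ultra_cone_rel G N d \<omega> =
    {(g, h). g \<in> carrier (bounded_seq_group G N d) \<and> h \<in> carrier (bounded_seq_group G N d) \<and>
      ((\<lambda>n. N (inv\<^bsub>G\<^esub> g n \<otimes>\<^bsub>G\<^esub> h n) / d n) \<longlongrightarrow> 0) \<omega>}"

definition ultra_cone ::
    "('a, 'm) monoid_scheme \<Rightarrow> ('a \<Rightarrow> real) \<Rightarrow> (nat \<Rightarrow> real) \<Rightarrow> nat filter \<Rightarrow> (nat \<Rightarrow> 'a) set monoid"
  where "ultra_cone G N d \<omega> = quotient_monoid (bounded_seq_group G N d) (ultra_cone_rel G N d \<omega>)"

definition ultra_cone_class ::
    "('a, 'm) monoid_scheme \<Rightarrow> ('a \<Rightarrow> real) \<Rightarrow> (nat \<Rightarrow> real) \<Rightarrow> nat filter \<Rightarrow> (nat \<Rightarrow> 'a) \<Rightarrow> (nat \<Rightarrow> 'a) set"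
  where "ultra_cone_class G N d \<omega> g = ultra_cone_rel G N d \<omega> `` {g}"

definition ultra_cone_norm ::
    "('a, 'm) monoid_scheme \<Rightarrow> ('a \<Rightarrow> real) \<Rightarrow> (nat \<Rightarrow> real) \<Rightarrow> nat filter \<Rightarrow> (nat \<Rightarrow> 'a) set \<Rightarrow> real"
  where "ultra_cone_norm G N d \<omega> X = the_elem ((\<lambda>g. Lim \<omega> (\<lambda>n. N (g n) / d n)) ` X)"

end

theory Submission
  imports Defs
begin

text \<open>
  The map is given on representatives by \<open>g \<mapsto> g \<circ> d\<close>, so everything rests on one estimate: for
  \<open>w \<in> \<D>(G,T)\<close> the number \<open>\<parallel>\<pi>(w(t))\<parallel> / t\<close> is at most \<open>\<parallel>\<psi>\<^bsub>1/t\<^esub>(w(t))\<parallel>\<close>, which converges to \<open>\<parallel>w\<parallel>\<close>.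
  Given this, \<open>(\<pi> \<circ> w) \<circ> d\<close> is a bounded sequence whose \<open>\<omega>\<close>-limit norm is at most \<open>\<parallel>w\<parallel>\<close>; taking the
  infimum over \<open>w\<close> bounds it by the pseudonorm of \<open>\<pi> \<circ> w\<close> in \<open>\<C>(G,T)\<close>. Hence elements of pseudonorm
  zero go to the unit, and the induced homomorphism is Lipschitz with constant 1.

  As \<open>\<psi>\<^sub>t\<close> multiplies norms by at most \<open>t\<close> and inverts \<open>\<psi>\<^bsub>1/t\<^esub>\<close>, the estimate reduces to
  \<open>\<parallel>\<pi>(x)\<parallel> \<le> \<parallel>x\<parallel>\<close> for \<open>x \<in> F(G)\<close> (lemma \<open>norm_eval_hom_le\<close>). This is not immediate: the norm on the right
  allows conjugates of arbitrary real powers, to which \<open>\<pi>\<close> does not apply. The way out is to describe the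
  norm by cancellation instead of by products of conjugates. A word in the letters \<open>(g, r)\<close> is deleted at
  cost \<open>c\<close> if it can be reduced to the empty word by merging adjacent letters of the same index, which is
  free, and by removing letters, where \<open>(g, r)\<close> costs \<open>\<bar>r\<bar> \<parallel>g\<parallel>\<close>. Three facts give the inequality:

  \<^item> A product of conjugates is deleted at its cost: remove the middle letters, then every conjugating word
    cancels against its inverse (\<open>conj_prod_deletable\<close>).
  \<^item> The deletion cost depends only on the element of the free product (\<open>deletable_rel\<close>), so it may be
    computed from a word with integral exponents if the element lies in \<open>F(G)\<close>.
  \<^item> Starting from integral exponents, merging and removing never leave the integers. Merging does
    not change the value of the word in \<open>G\<close>, and removing a letter changes its norm by at most the cost,
    since the norm is conjugation-invariant (\<open>norm_word_eval_le_deletion_cost\<close>).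

  With cost zero the same argument shows that \<open>\<pi>\<close> is well defined: integral words that represent the same
  element of the free product have values at distance zero (\<open>word_eval_eq\<close>).
\<close>

section \<open>Quotients of monoids by congruences\<close>

lemma group_homI: "\<lbrakk>group K; group H; \<phi> \<in> hom K H\<rbrakk> \<Longrightarrow> group_hom K H \<phi>"
  by (simp add: group_hom_def group_hom_axioms_def)

locale monoid_congruence = monoid M for M (structure) +
  fixes r :: "('a \<times> 'a) set"
  assumes equiv: "equiv (carrier M) r"
    and compat: "\<lbrakk>(x, x') \<in> r; (y, y') \<in> r\<rbrakk> \<Longrightarrow> (x \<otimes> y, x' \<otimes> y') \<in> r"
begin

abbreviation cls where "cls x \<equiv> r `` {x}"

lemma one_quotient_monoid: "\<one>\<^bsub>quotient_monoid M r\<^esub> = cls \<one>"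
  by (simp add: quotient_monoid_def)

lemma class_in_quotient: "x \<in> carrier M \<Longrightarrow> cls x \<in> carrier (quotient_monoid M r)"
  by (simp add: quotient_monoid_def quotientI)

lemma quotient_classE:
  assumes "X \<in> carrier (quotient_monoid M r)"
  obtains x where "x \<in> carrier M" "X = cls x"
  using assms by (auto simp: quotient_monoid_def elim: quotientE)

lemma class_eq_iff:
  "\<lbrakk>x \<in> carrier M; y \<in> carrier M\<rbrakk> \<Longrightarrow> cls x = cls y \<longleftrightarrow> (x, y) \<in> r"
  using eq_equiv_class_iff[OF equiv] by blast

lemma mult_classes:
  assumes x: "x \<in> carrier M" and y: "y \<in> carrier M"
  shows "cls x \<otimes>\<^bsub>quotient_monoid M r\<^esub> cls y = cls (x \<otimes> y)"
proof -
  have const: "cls (x' \<otimes> y') = cls (x \<otimes> y)" if "(x, x') \<in> r" "(y, y') \<in> r" for x' y'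
    by (rule equiv_class_eq[OF equiv compat[OF that], symmetric])
  have self: "(x, x) \<in> r" "(y, y) \<in> r"
    using x y equiv_class_self[OF equiv] by auto
  have "cls x \<otimes>\<^bsub>quotient_monoid M r\<^esub> cls y = (\<Union>x'\<in>cls x. \<Union>y'\<in>cls y. cls (x' \<otimes> y'))"
    by (simp add: quotient_monoid_def)
  also have "\<dots> = (\<Union>x'\<in>cls x. \<Union>y'\<in>cls y. cls (x \<otimes> y))"
    by (intro SUP_cong HOL.refl const) auto
  also have "\<dots> = cls (x \<otimes> y)"
    using self by auto
  finally show ?thesis .
qed

lemma monoid_quotient: "monoid (quotient_monoid M r)"
proof (rule monoidI)
  fix X Y Z
  assume X: "X \<in> carrier (quotient_monoid M r)" and Y: "Y \<in> carrier (quotient_monoid M r)"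
  then show "X \<otimes>\<^bsub>quotient_monoid M r\<^esub> Y \<in> carrier (quotient_monoid M r)"
    by (elim quotient_classE) (simp add: mult_classes class_in_quotient)
  assume Z: "Z \<in> carrier (quotient_monoid M r)"
  show "X \<otimes>\<^bsub>quotient_monoid M r\<^esub> Y \<otimes>\<^bsub>quotient_monoid M r\<^esub> Z
      = X \<otimes>\<^bsub>quotient_monoid M r\<^esub> (Y \<otimes>\<^bsub>quotient_monoid M r\<^esub> Z)"
    using X Y Z by (elim quotient_classE) (simp add: mult_classes m_assoc)
qed (auto simp: one_quotient_monoid class_in_quotient mult_classes elim!: quotient_classE)

lemma group_quotient:
  assumes "\<And>x. x \<in> carrier M \<Longrightarrow> \<exists>y\<in>carrier M. (y \<otimes> x, \<one>) \<in> r"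
  shows "group (quotient_monoid M r)"
proof -
  interpret Q: monoid "quotient_monoid M r" by (rule monoid_quotient)
  show ?thesis
  proof (rule groupI)
    fix X assume "X \<in> carrier (quotient_monoid M r)"
    then obtain x where x: "x \<in> carrier M" "X = cls x" by (rule quotient_classE)
    then obtain y where y: "y \<in> carrier M" "(y \<otimes> x, \<one>) \<in> r" using assms by blast
    have "cls y \<otimes>\<^bsub>quotient_monoid M r\<^esub> X = \<one>\<^bsub>quotient_monoid M r\<^esub>"
      using x y by (simp add: mult_classes one_quotient_monoid class_eq_iff)
    then show "\<exists>Y\<in>carrier (quotient_monoid M r).
        Y \<otimes>\<^bsub>quotient_monoid M r\<^esub> X = \<one>\<^bsub>quotient_monoid M r\<^esub>"
      using class_in_quotient y(1) by blast
  qed (auto simp: Q.m_assoc)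
qed

lemma class_hom: "cls \<in> hom M (quotient_monoid M r)"
  by (rule homI) (simp_all add: class_in_quotient mult_classes)

end


section \<open>Free products of groups\<close>

locale group_family =
  fixes I :: "'i set" and A :: "'i \<Rightarrow> ('a, 'm) monoid_scheme"
  assumes group_A: "i \<in> I \<Longrightarrow> group (A i)"
begin

abbreviation W where "W \<equiv> carrier (free_product_words I A)"
abbreviation rel where "rel \<equiv> free_product_rel I A"

lemma one_A: "i \<in> I \<Longrightarrow> \<one>\<^bsub>A i\<^esub> \<in> carrier (A i)"
  by (rule monoid.one_closed[OF group.is_monoid[OF group_A]])

lemma mult_A:
  "\<lbrakk>i \<in> I; a \<in> carrier (A i); b \<in> carrier (A i)\<rbrakk> \<Longrightarrow> a \<otimes>\<^bsub>A i\<^esub> b \<in> carrier (A i)"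
  by (rule monoid.m_closed[OF group.is_monoid[OF group_A]])

lemma words_simps [simp]:
  "[] \<in> W" "x # u \<in> W \<longleftrightarrow> fst x \<in> I \<and> snd x \<in> carrier (A (fst x)) \<and> u \<in> W"
  "u @ v \<in> W \<longleftrightarrow> u \<in> W \<and> v \<in> W"
  by (cases x; auto simp: free_product_words_def)+

lemma words_mult [simp]: "u \<otimes>\<^bsub>free_product_words I A\<^esub> v = u @ v"
  and words_one [simp]: "\<one>\<^bsub>free_product_words I A\<^esub> = []"
  by (simp_all add: free_product_words_def)

lemma rel_words: "(u, v) \<in> rel \<Longrightarrow> u \<in> W \<and> v \<in> W"
  by (induction rule: free_product_rel.induct) (auto simp: one_A mult_A)

lemma rel_context:
  assumes "(u, v) \<in> rel" "p \<in> W" "q \<in> W"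
  shows "(p @ u @ q, p @ v @ q) \<in> rel"
  using assms
proof (induction rule: free_product_rel.induct)
  case (one u v i)
  then show ?case using free_product_rel.one[of "p @ u" I A "v @ q" i] by simp
next
  case (mult u v i a b)
  then show ?case using free_product_rel.mult[of "p @ u" I A "v @ q" i a b] by simp
qed (auto intro: free_product_rel.refl free_product_rel.sym free_product_rel.trans)

sublocale words: monoid_congruence "free_product_words I A" rel
proof (unfold_locales; (simp; fail)?)
  show "equiv W rel"
    by (rule equivI)
       (auto simp: refl_on_def sym_def trans_def free_product_rel.refl dest: rel_words
          intro: free_product_rel.sym free_product_rel.trans)
  fix x x' y y'
  assume xy: "(x, x') \<in> rel" "(y, y') \<in> rel"
  have "(x @ y, x' @ y) \<in> rel" using rel_context[OF xy(1), of "[]" y] rel_words xy by simp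
  moreover have "(x' @ y, x' @ y') \<in> rel" using rel_context[OF xy(2), of x' "[]"] rel_words xy by simp
  ultimately show "(x \<otimes>\<^bsub>free_product_words I A\<^esub> y, x' \<otimes>\<^bsub>free_product_words I A\<^esub> y') \<in> rel"
    by (auto intro: free_product_rel.trans)
qed

definition inv_word where "inv_word u = rev (map (\<lambda>(i, a). (i, inv\<^bsub>A i\<^esub> a)) u)"

lemma inv_word_simps [simp]:
  "inv_word [] = []" "inv_word (x # u) = inv_word u @ [(fst x, inv\<^bsub>A (fst x)\<^esub> snd x)]"
  by (auto simp: inv_word_def split: prod.splits)

lemma inv_word_in_words [simp]: "u \<in> W \<Longrightarrow> inv_word u \<in> W"
  by (induction u) (auto simp: group.inv_closed[OF group_A])

lemma inv_word_append_rel: "u \<in> W \<Longrightarrow> (inv_word u @ u, []) \<in> rel"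
proof (induction u)
  case (Cons x u)
  obtain i a where x: "x = (i, a)" by force
  have i: "i \<in> I" "a \<in> carrier (A i)" and u: "u \<in> W" using Cons x by auto
  then have inv: "inv\<^bsub>A i\<^esub> a \<in> carrier (A i)" "inv\<^bsub>A i\<^esub> a \<otimes>\<^bsub>A i\<^esub> a = \<one>\<^bsub>A i\<^esub>"
    by (simp_all add: group.inv_closed[OF group_A] group.l_inv[OF group_A])
  have "(inv_word u @ [(i, inv\<^bsub>A i\<^esub> a), (i, a)] @ u, inv_word u @ [(i, \<one>\<^bsub>A i\<^esub>)] @ u) \<in> rel"
    using free_product_rel.mult[of "inv_word u" I A u i "inv\<^bsub>A i\<^esub> a" a] i u inv by simp
  moreover have "(inv_word u @ [(i, \<one>\<^bsub>A i\<^esub>)] @ u, inv_word u @ u) \<in> rel"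
    using i u by (intro free_product_rel.one) auto
  ultimately have "(inv_word u @ [(i, inv\<^bsub>A i\<^esub> a), (i, a)] @ u, []) \<in> rel"
    using Cons.IH[OF u] by (blast intro: free_product_rel.trans)
  then show ?case by (simp add: x)
qed (auto intro: free_product_rel.refl)

lemma free_product_eq: "free_product I A = quotient_monoid (free_product_words I A) rel"
  by (simp add: free_product_def)

lemma group_free_product: "group (free_product I A)"
  unfolding free_product_eq
proof (rule words.group_quotient)
  fix u assume "u \<in> W"
  then show "\<exists>v\<in>W. (v \<otimes>\<^bsub>free_product_words I A\<^esub> u, \<one>\<^bsub>free_product_words I A\<^esub>) \<in> rel"
    by (intro bexI[of _ "inv_word u"]) (simp_all add: inv_word_append_rel)
qed

lemma class_append:
  "\<lbrakk>u \<in> W; v \<in> W\<rbrakk> \<Longrightarrow> words.cls (u @ v) = words.cls u \<otimes>\<^bsub>free_product I A\<^esub> words.cls v"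
  by (simp add: free_product_eq words.mult_classes)

lemma class_Nil: "words.cls [] = \<one>\<^bsub>free_product I A\<^esub>"
  by (simp add: free_product_eq words.one_quotient_monoid)

lemma class_closed: "u \<in> W \<Longrightarrow> words.cls u \<in> carrier (free_product I A)"
  by (simp add: free_product_eq words.class_in_quotient)

lemma class_inv_word:
  assumes "u \<in> W" shows "words.cls (inv_word u) = inv\<^bsub>free_product I A\<^esub> words.cls u"
proof -
  have "words.cls (inv_word u) \<otimes>\<^bsub>free_product I A\<^esub> words.cls u = \<one>\<^bsub>free_product I A\<^esub>"
    using inv_word_append_rel[OF assms] assms
    by (simp add: words.class_eq_iff flip: class_append class_Nil)
  then show ?thesis
    using group.inv_equality[OF group_free_product] assms by (simp add: class_closed)
qed

lemma incl_closed:
  "\<lbrakk>i \<in> I; a \<in> carrier (A i)\<rbrakk> \<Longrightarrow> free_product_incl I A i a \<in> carrier (free_product I A)"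
  unfolding free_product_incl_def by (rule class_closed) simp

lemma class_Cons:
  "\<lbrakk>i \<in> I; a \<in> carrier (A i); u \<in> W\<rbrakk> \<Longrightarrow>
    words.cls ((i, a) # u) = free_product_incl I A i a \<otimes>\<^bsub>free_product I A\<^esub> words.cls u"
  using class_append[of "[(i, a)]" u] by (simp add: free_product_incl_def)

text \<open>The next two lemmas are the uniqueness and the existence part of the universal property.\<close>

lemma hom_eq_on_free_product:
  assumes "group H" "\<phi> \<in> hom (free_product I A) H" "\<psi> \<in> hom (free_product I A) H"
    and eq: "\<And>i a. \<lbrakk>i \<in> I; a \<in> carrier (A i)\<rbrakk>
      \<Longrightarrow> \<phi> (free_product_incl I A i a) = \<psi> (free_product_incl I A i a)"
    and X: "X \<in> carrier (free_product I A)"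
  shows "\<phi> X = \<psi> X"
proof -
  interpret \<phi>: group_hom "free_product I A" H \<phi>
    by (intro group_homI group_free_product assms)
  interpret \<psi>: group_hom "free_product I A" H \<psi>
    by (intro group_homI group_free_product assms)
  obtain u where "u \<in> W" "X = words.cls u"
    using X unfolding free_product_eq by (rule words.quotient_classE)
  moreover from \<open>u \<in> W\<close> have "\<phi> (words.cls u) = \<psi> (words.cls u)"
    by (induction u) (auto simp: class_Nil class_Cons incl_closed class_closed eq)
  ultimately show ?thesis by simp
qed

lemma free_product_lift:
  assumes "group H" and f: "\<And>i. i \<in> I \<Longrightarrow> f i \<in> hom (A i) H"
  obtains \<phi> where "\<phi> \<in> hom (free_product I A) H"
    "\<And>i a. \<lbrakk>i \<in> I; a \<in> carrier (A i)\<rbrakk> \<Longrightarrow> \<phi> (free_product_incl I A i a) = f i a"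
proof -
  interpret H: group H by fact
  define ev where "ev u = foldr (\<lambda>(i, a) y. f i a \<otimes>\<^bsub>H\<^esub> y) u \<one>\<^bsub>H\<^esub>" for u
  have f_closed: "f i a \<in> carrier H" if "i \<in> I" "a \<in> carrier (A i)" for i a
    using f[OF that(1)] that(2) by (auto simp: hom_def)
  have ev_simps [simp]: "ev [] = \<one>\<^bsub>H\<^esub>" "ev ((i, a) # u) = f i a \<otimes>\<^bsub>H\<^esub> ev u" for i a u
    by (simp_all add: ev_def)
  have ev_closed [simp]: "ev u \<in> carrier H" if "u \<in> W" for u
    using that by (induction u) (auto simp: f_closed)
  have ev_append: "ev (u @ v) = ev u \<otimes>\<^bsub>H\<^esub> ev v" if "u \<in> W" "v \<in> W" for u v
    using that by (induction u) (auto simp: f_closed H.m_assoc)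
  have ev_rel: "ev u = ev v" if "(u, v) \<in> rel" for u v
    using that
  proof (induction rule: free_product_rel.induct)
    case (one u v i)
    then have "f i \<one>\<^bsub>A i\<^esub> = \<one>\<^bsub>H\<^esub>"
      using f hom_one group_A H.is_group by metis
    then show ?case using one by (simp add: ev_append one_A)
  next
    case (mult u v i a b)
    then have "f i (a \<otimes>\<^bsub>A i\<^esub> b) = f i a \<otimes>\<^bsub>H\<^esub> f i b"
      using f hom_mult by metis
    then show ?case using mult by (simp add: ev_append f_closed mult_A H.m_assoc)
  qed auto
  define \<phi> where "\<phi> X = ev (SOME u. u \<in> X)" for X
  have \<phi>: "\<phi> (words.cls u) = ev u" if "u \<in> W" for u
  proof -
    have "u \<in> words.cls u" using that by (simp add: free_product_rel.refl)
    then have "(SOME v. v \<in> words.cls u) \<in> words.cls u" by (rule someI)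
    then show ?thesis using ev_rel by (metis \<phi>_def Image_singleton_iff)
  qed
  show thesis
  proof
    show "\<phi> \<in> hom (free_product I A) H"
      unfolding free_product_eq
      by (rule homI) (auto elim!: words.quotient_classE simp: \<phi> words.mult_classes ev_append)
    show "\<phi> (free_product_incl I A i a) = f i a" if "i \<in> I" "a \<in> carrier (A i)" for i a
      using that by (simp add: free_product_incl_def \<phi> f_closed)
  qed
qed

end


section \<open>The cost of deleting a word\<close>

text \<open>
  \<open>deletable N w c\<close> says that the word \<open>w\<close> in the letters \<open>(g, r)\<close> can be brought to the empty word
  at a cost of at most \<open>c\<close>, where adjacent letters with the same index may be merged for free and
  removing a letter \<open>(g, r)\<close> costs \<open>\<bar>r\<bar> * N g\<close>. Merging is read backwards here, as splitting. The
  point of the definition is that all moves shorten the word: no letter is ever inserted, so a word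
  with integral exponents keeps integral exponents until it is gone.
\<close>

inductive deletable :: "('i \<Rightarrow> real) \<Rightarrow> ('i \<times> real) list \<Rightarrow> real \<Rightarrow> bool" for N where
  nil: "0 \<le> c \<Longrightarrow> deletable N [] c"
| delete: "\<lbrakk>deletable N (u @ v) c; c + \<bar>r\<bar> * N g \<le> c'\<rbrakk> \<Longrightarrow> deletable N (u @ (g, r) # v) c'"
| split: "deletable N (u @ (g, a + b) # v) c \<Longrightarrow> deletable N (u @ (g, a) # (g, b) # v) c"

lemma deletable_mono: "deletable N w c \<Longrightarrow> c \<le> c' \<Longrightarrow> deletable N w c'"
proof (induction arbitrary: c' rule: deletable.induct)
  case (delete u v c r g c1)
  then show ?case using deletable.delete[of N u v c r g c'] by simp
qed (auto intro: deletable.nil deletable.split)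

lemma append_Cons_eq_append_Cons_cases:
  assumes "u @ x # v = u' @ y # v'"
  obtains (same) "u' = u" "x = y" "v' = v"
  | (right) m where "u' = u @ x # m" "v = m @ y # v'"
  | (left) m where "u = u' @ y # m" "v' = m @ x # v"
  using assms by (auto simp: append_eq_append_conv2 Cons_eq_append_conv append_eq_Cons_conv)

lemma Cons_eq_append_Cons_cases:
  assumes "x # v = m @ y # v'"
  obtains (same) "m = []" "x = y" "v' = v"
  | (right) m' where "m = x # m'" "v = m' @ y # v'"
  using assms by (auto simp: Cons_eq_append_conv)

text \<open>The deletion of the given word is repeated with the changed exponent. It is carried along when its
  letter is merged, until the resulting letter is removed, and only there the change has to be paid for.\<close>

lemma deletable_change:
  assumes "deletable N w c" and "w = u @ (g, s) # v" and N: "0 \<le> N g"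
  shows "deletable N (u @ (g, s') # v) (c + \<bar>s - s'\<bar> * N g)"
  using assms(1,2)
proof (induction arbitrary: u v s s' rule: deletable.induct)
  case (delete u1 v1 c r k c')
  from delete.prems show ?case
  proof (cases rule: append_Cons_eq_append_Cons_cases)
    case same
    have "\<bar>s'\<bar> * N g \<le> (\<bar>s\<bar> + \<bar>s - s'\<bar>) * N g" by (rule mult_right_mono[OF _ N]) simp
    then have "c + \<bar>s'\<bar> * N g \<le> c' + \<bar>s - s'\<bar> * N g"
      using delete.hyps(2) same by (simp add: distrib_right)
    then show ?thesis using delete.hyps(1) same by (auto intro: deletable.delete)
  next
    case (right m)
    have "deletable N (u1 @ m @ (g, s') # v) (c + \<bar>s - s'\<bar> * N g)"
      using delete.IH[of "u1 @ m" s v] right by simp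
    then show ?thesis
      using deletable.delete[of N u1 "m @ (g, s') # v"] delete.hyps(2) right by simp
  next
    case (left m)
    have "deletable N (u @ (g, s') # m @ v1) (c + \<bar>s - s'\<bar> * N g)"
      using delete.IH[of u s "m @ v1"] left by simp
    then show ?thesis
      using deletable.delete[of N "u @ (g, s') # m" v1] delete.hyps(2) left by simp
  qed
next
  case (split u1 k a b v1 c)
  from split.prems show ?case
  proof (cases rule: append_Cons_eq_append_Cons_cases)
    case same
    have "deletable N (u @ (g, s' + b) # v1) (c + \<bar>s - s'\<bar> * N g)"
      using split.IH[of u "s + b" v1 "s' + b"] same by simp
    then show ?thesis using same deletable.split by fastforce
  next
    case (left m)
    have "deletable N (u @ (g, s') # m @ (k, a + b) # v1) (c + \<bar>s - s'\<bar> * N g)"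
      using split.IH[of u s "m @ (k, a + b) # v1"] left by simp
    then show ?thesis using deletable.split[of N "u @ (g, s') # m"] left by simp
  next
    case (right m)
    from right(2) show ?thesis
    proof (cases rule: Cons_eq_append_Cons_cases)
      case same
      have "deletable N (u1 @ (g, a + s') # v1) (c + \<bar>s - s'\<bar> * N g)"
        using split.IH[of u1 "a + s" v1 "a + s'"] same by simp
      then show ?thesis using same right deletable.split by fastforce
    next
      case (right m')
      have "deletable N (u1 @ (k, a + b) # m' @ (g, s') # v) (c + \<bar>s - s'\<bar> * N g)"
        using split.IH[of "u1 @ (k, a + b) # m'" s v] right by simp
      then show ?thesis
        using deletable.split[of N u1 k a b] right \<open>u = u1 @ (k, a) # m\<close> by simp
    qed
  qed
qed simp

text \<open>Removing a letter from a word costs as much as it does during a deletion: if the letter was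
  merged with a neighbour, the neighbour has to make up for the missing exponent.\<close>

lemma deletable_remove:
  assumes "deletable N w c" and "w = u @ (g, s) # v" and N: "0 \<le> N g"
  shows "deletable N (u @ v) (c + \<bar>s\<bar> * N g)"
  using assms(1,2)
proof (induction arbitrary: u v s rule: deletable.induct)
  case (delete u1 v1 c r k c')
  from delete.prems show ?case
  proof (cases rule: append_Cons_eq_append_Cons_cases)
    case same
    have "0 \<le> \<bar>s\<bar> * N g" using N by simp
    then have "c \<le> c' + \<bar>s\<bar> * N g" using delete.hyps(2) same by simp
    then show ?thesis using delete.hyps(1) same by (auto intro: deletable_mono)
  next
    case (right m)
    have "deletable N (u1 @ m @ v) (c + \<bar>s\<bar> * N g)"
      using delete.IH[of "u1 @ m" s v] right by simp
    then show ?thesis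
      using deletable.delete[of N u1 "m @ v"] delete.hyps(2) right by simp
  next
    case (left m)
    have "deletable N ((u @ m) @ v1) (c + \<bar>s\<bar> * N g)"
      using delete.IH[of u s "m @ v1"] left by simp
    then show ?thesis
      using deletable.delete[of N "u @ m" v1] delete.hyps(2) left by simp
  qed
next
  case (split u1 k a b v1 c)
  from split.prems show ?case
  proof (cases rule: append_Cons_eq_append_Cons_cases)
    case same
    then show ?thesis
      using deletable_change[OF split.hyps HOL.refl, of b] N by simp
  next
    case (left m)
    have "deletable N ((u @ m) @ (k, a + b) # v1) (c + \<bar>s\<bar> * N g)"
      using split.IH[of u s "m @ (k, a + b) # v1"] left by simp
    then show ?thesis using deletable.split[of N "u @ m"] left by simp
  next
    case (right m)
    from right(2) show ?thesis
    proof (cases rule: Cons_eq_append_Cons_cases)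
      case same
      then show ?thesis
        using deletable_change[OF split.hyps HOL.refl, of a] N right by simp
    next
      case (right m')
      have "deletable N (u1 @ (k, a + b) # m' @ v) (c + \<bar>s\<bar> * N g)"
        using split.IH[of "u1 @ (k, a + b) # m'" s v] right by simp
      then show ?thesis
        using deletable.split[of N u1 k a b] right \<open>u = u1 @ (k, a) # m\<close> by simp
    qed
  qed
qed simp

text \<open>If one of the two letters was removed on its own, its cost pays for adding its exponent to the other
  letter. If one of them was merged with its outer neighbour first, the order of the merges is exchanged.\<close>

lemma deletable_merge:
  assumes "deletable N w c" and "w = u @ (g, a) # (g, b) # v" and N: "0 \<le> N g"
  shows "deletable N (u @ (g, a + b) # v) c"
  using assms(1,2)
proof (induction arbitrary: u v a b rule: deletable.induct)
  case (delete u1 v1 c r k c')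
  from delete.prems show ?case
  proof (cases rule: append_Cons_eq_append_Cons_cases)
    case same
    then have "deletable N (u @ (g, a + b) # v) (c + \<bar>a\<bar> * N g)"
      using deletable_change[OF delete.hyps(1), of u g b v "a + b"] N by simp
    then show ?thesis using delete.hyps(2) same by (auto intro: deletable_mono)
  next
    case (right m)
    have "deletable N (u1 @ m @ (g, a + b) # v) c"
      using delete.IH[of "u1 @ m" a b v] right by simp
    then show ?thesis
      using deletable.delete[of N u1 "m @ (g, a + b) # v"] delete.hyps(2) right by simp
  next
    case (left m)
    note u1 = left(1)
    from left(2) show ?thesis
    proof (cases rule: Cons_eq_append_Cons_cases)
      case same
      then have "deletable N (u @ (g, a + b) # v) (c + \<bar>b\<bar> * N g)"
        using deletable_change[OF delete.hyps(1), of u g a v "a + b"] N u1 by simp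
      then show ?thesis using delete.hyps(2) same by (auto intro: deletable_mono)
    next
      case (right m')
      have "deletable N (u @ (g, a + b) # m' @ v1) c"
        using delete.IH[of u a b "m' @ v1"] right u1 by simp
      then show ?thesis
        using deletable.delete[of N "u @ (g, a + b) # m'" v1] delete.hyps(2) right by simp
    qed
  qed
next
  case (split u1 k x y v1 c)
  from split.prems show ?case
  proof (cases rule: append_Cons_eq_append_Cons_cases)
    case same
    then show ?thesis using split.hyps by simp
  next
    case (right m)
    from right(2) show ?thesis
    proof (cases rule: Cons_eq_append_Cons_cases)
      case same
      have "deletable N (u1 @ (g, x + (a + b)) # v) c"
        using split.IH[of u1 "x + a" b v] same by (simp add: add.assoc)
      then show ?thesis using deletable.split same right by fastforce
    next
      case (right m')
      have "deletable N (u1 @ (k, x + y) # m' @ (g, a + b) # v) c"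
        using split.IH[of "u1 @ (k, x + y) # m'" a b v] right by simp
      then show ?thesis
        using deletable.split[of N u1 k x y] right \<open>u = u1 @ (k, x) # m\<close> by simp
    qed
  next
    case (left m)
    from left(2) show ?thesis
    proof (cases rule: Cons_eq_append_Cons_cases)
      case same
      have "deletable N (u @ (g, (a + b) + y) # v1) c"
        using split.IH[of u a "b + y" v1] same left by (simp add: add.assoc)
      then show ?thesis using deletable.split same left by fastforce
    next
      case (right m')
      have "deletable N (u @ (g, a + b) # m' @ (k, x + y) # v1) c"
        using split.IH[of u a b "m' @ (k, x + y) # v1"] right left by simp
      then show ?thesis
        using deletable.split[of N "u @ (g, a + b) # m'" k x y] right by simp
    qed
  qed
qed simp

text \<open>The defining relations of the free product, read in both directions, are the removal and the insertion
  of a trivial letter, which is free, and the merging and the splitting of letters.\<close>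

lemma deletable_rel:
  assumes "(u, v) \<in> free_product_rel I (\<lambda>_. real_group)" and N: "\<And>g. 0 \<le> N g"
  shows "deletable N u c \<longleftrightarrow> deletable N v c"
  using assms(1)
proof (induction rule: free_product_rel.induct)
  case (one u v i)
  show ?case
  proof
    assume "deletable N (u @ [(i, \<one>\<^bsub>real_group\<^esub>)] @ v) c"
    then show "deletable N (u @ v) c"
      using deletable_remove[of N _ c u i 0 v] N by (simp add: real_group_def)
  next
    assume "deletable N (u @ v) c"
    then show "deletable N (u @ [(i, \<one>\<^bsub>real_group\<^esub>)] @ v) c"
      using deletable.delete[of N u v c 0] by (simp add: real_group_def)
  qed
next
  case (mult u v i a b)
  show ?case
    using deletable.split[of N u i a b v c] deletable_merge[of N "u @ (i, a) # (i, b) # v" c u i a b v] N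
    by (auto simp: real_group_def)
qed simp_all

abbreviation neg_word :: "('i \<times> real) list \<Rightarrow> ('i \<times> real) list"
  where "neg_word u \<equiv> rev (map (\<lambda>(g, r). (g, - r)) u)"

lemma deletable_cancel: "deletable N (p @ v) c \<Longrightarrow> deletable N (p @ h @ neg_word h @ v) c"
proof (induction h arbitrary: p v)
  case (Cons x h)
  obtain g r where x: "x = (g, r)" by force
  have "deletable N (p @ (g, r + - r) # v) c"
    using Cons.prems by (auto intro: deletable.delete)
  then have "deletable N ((p @ [(g, r)]) @ (g, - r) # v) c"
    using deletable.split[of N p g r "- r" v c] by simp
  from Cons.IH[OF this] show ?case by (simp add: x)
qed simp

text \<open>Once the middle letter is gone, the conjugating word meets its inverse.\<close>

lemma deletable_conj:
  assumes "deletable N v c"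
  shows "deletable N (h @ (g, r) # neg_word h @ v) (\<bar>r\<bar> * N g + c)"
  using deletable.delete[of N h "neg_word h @ v" c r g] deletable_cancel[of N "[]"] assms by simp

section \<open>The group $F_{\mathbb{R}}(G)$ and its products of conjugates\<close>

lemma group_real_group: "group real_group"
  by (rule groupI) (auto simp: real_group_def intro: exI[of _ "- _"])

lemma real_group_simps [simp]:
  "carrier real_group = UNIV" "\<one>\<^bsub>real_group\<^esub> = 0" "a \<otimes>\<^bsub>real_group\<^esub> b = a + b"
  by (simp_all add: real_group_def)

lemma inv_real_group [simp]: "inv\<^bsub>real_group\<^esub> a = - a"
  by (rule group.inv_equality[OF group_real_group]) simp_all

lemma conj_prod_Nil [simp]: "conj_prod G [] = \<one>\<^bsub>FR G\<^esub>"
  by (simp add: conj_prod_def)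

lemma conj_prod_Cons [simp]:
  "conj_prod G ((h, g, r, e) # cs) =
    (h \<otimes>\<^bsub>FR G\<^esub> (gen G g r [^]\<^bsub>FR G\<^esub> e) \<otimes>\<^bsub>FR G\<^esub> inv\<^bsub>FR G\<^esub> h) \<otimes>\<^bsub>FR G\<^esub> conj_prod G cs"
  by (simp add: conj_prod_def)

abbreviation conj_factors where
  "conj_factors G \<equiv> carrier (FR G) \<times> carrier G \<times> (UNIV :: real set) \<times> {1, - 1 :: int}"

abbreviation conj_cost :: "('a \<Rightarrow> real) \<Rightarrow> ('b \<times> 'a \<times> real \<times> int) list \<Rightarrow> real" where
  "conj_cost N cs \<equiv> (\<Sum>(h, g, r, e)\<leftarrow>cs. \<bar>r\<bar> * N g)"

context conj_inv_normed_group
begin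

sublocale fp: group_family "carrier G" "\<lambda>_. real_group"
  by (rule group_family.intro) (rule group_real_group)

sublocale FR: group "FR G"
  unfolding FR_def by (rule fp.group_free_product)

abbreviation word_class where "word_class \<equiv> fp.words.cls"

lemma inv_word_real [simp]: "fp.inv_word u = neg_word u"
  by (simp add: fp.inv_word_def)

lemma neg_word_in_words [simp]: "u \<in> fp.W \<Longrightarrow> neg_word u \<in> fp.W"
  using fp.inv_word_in_words by simp

lemmas word_class_append = fp.class_append[folded FR_def]
  and word_class_Nil = fp.class_Nil[folded FR_def]
  and word_class_closed [simp] = fp.class_closed[folded FR_def]

lemma word_class_neg: "u \<in> fp.W \<Longrightarrow> word_class (neg_word u) = inv\<^bsub>FR G\<^esub> word_class u"
  using fp.class_inv_word[folded FR_def] by simp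

lemma FR_cases:
  assumes "x \<in> carrier (FR G)"
  obtains u where "u \<in> fp.W" "x = word_class u"
  using assms unfolding FR_def fp.free_product_eq by (rule fp.words.quotient_classE)

lemma gen_eq: "gen G g r = word_class [(g, r)]"
  by (simp add: gen_def free_product_incl_def)

lemma gen_closed [simp]: "g \<in> carrier G \<Longrightarrow> gen G g r \<in> carrier (FR G)"
  by (simp add: gen_eq)

lemma gen_add:
  assumes "g \<in> carrier G"
  shows "gen G g (a + b) = gen G g a \<otimes>\<^bsub>FR G\<^esub> gen G g b"
proof -
  have "word_class ([(g, a)] @ [(g, b)]) = word_class [(g, a + b)]"
    using free_product_rel.mult[of "[]" "carrier G" "\<lambda>_. real_group" "[]" g a b] assms
    by (simp add: fp.words.class_eq_iff)
  then show ?thesis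
    using assms by (simp add: gen_eq flip: word_class_append)
qed

lemma gen_uminus: "g \<in> carrier G \<Longrightarrow> gen G g (- r) = inv\<^bsub>FR G\<^esub> gen G g r"
  using word_class_neg[of "[(g, r)]"] by (simp add: gen_eq)

lemma gen_sign_power:
  assumes "g \<in> carrier G" "e \<in> {1, - 1 :: int}"
  shows "gen G g r [^]\<^bsub>FR G\<^esub> e = gen G g (of_int e * r)"
  using assms by (auto simp: gen_uminus FR.int_pow_neg)

text \<open>Outside the carrier \<open>N\<close> may be negative; the absolute value makes it a weight on all letters.\<close>

abbreviation wt where "wt \<equiv> (\<lambda>g. \<bar>N g\<bar>)"

lemma conj_cost_wt:
  assumes "set cs \<subseteq> conj_factors G" shows "conj_cost wt cs = conj_cost N cs"
  using assms norm_nonneg by (intro arg_cong[of _ _ sum_list] map_cong) auto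

lemma conj_cost_nonneg:
  assumes "set cs \<subseteq> conj_factors G" shows "0 \<le> conj_cost N cs"
  by (subst conj_cost_wt[OF assms, symmetric]) (auto intro!: sum_list_nonneg)

lemma conj_prod_deletable:
  assumes "set cs \<subseteq> conj_factors G"
  shows "\<exists>w\<in>fp.W. conj_prod G cs = word_class w \<and> deletable wt w (conj_cost wt cs)"
  using assms
proof (induction cs)
  case Nil
  show ?case
    by (rule bexI[of _ "[]"]) (simp_all add: deletable.nil flip: word_class_Nil)
next
  case (Cons c cs)
  obtain h g r e where c: "c = (h, g, r, e)" by (cases c)
  with Cons.prems have h: "h \<in> carrier (FR G)" and g: "g \<in> carrier G" and e: "e \<in> {1, - 1}"
    by auto
  obtain w where w: "w \<in> fp.W" "conj_prod G cs = word_class w" "deletable wt w (conj_cost wt cs)"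
    using Cons by auto
  obtain u where u: "u \<in> fp.W" "h = word_class u" using h by (rule FR_cases)
  have "conj_prod G (c # cs) = word_class (u @ [(g, of_int e * r)] @ neg_word u @ w)"
    using u w g e
    by (simp add: c word_class_append word_class_neg gen_sign_power[unfolded gen_eq] gen_eq FR.m_assoc
        del: append_Cons append_Nil)
  moreover have "deletable wt (u @ [(g, of_int e * r)] @ neg_word u @ w) (conj_cost wt (c # cs))"
    using deletable_conj[OF w(3), of u g "of_int e * r"] e by (auto simp: c)
  ultimately show ?case using u w g by (intro bexI[of _ "u @ [(g, of_int e * r)] @ neg_word u @ w"]) auto
qed

lemma conj_prod_closed [simp]: "set cs \<subseteq> conj_factors G \<Longrightarrow> conj_prod G cs \<in> carrier (FR G)"
  using conj_prod_deletable by fastforce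

lemma conj_prod_append:
  assumes "set cs \<subseteq> conj_factors G" "set ds \<subseteq> conj_factors G"
  shows "conj_prod G (cs @ ds) = conj_prod G cs \<otimes>\<^bsub>FR G\<^esub> conj_prod G ds"
  using assms by (induction cs) (auto simp: FR.m_assoc)

lemma FR_is_conj_prod:
  assumes "x \<in> carrier (FR G)"
  obtains cs where "set cs \<subseteq> conj_factors G" "x = conj_prod G cs"
proof -
  obtain u where u: "u \<in> fp.W" "x = word_class u" using assms by (rule FR_cases)
  have "word_class u = conj_prod G (map (\<lambda>(g, r). (\<one>\<^bsub>FR G\<^esub>, g, r, 1)) u)" if "u \<in> fp.W" for u
    using that
  proof (induction u)
    case (Cons x u)
    then show ?case using word_class_append[of "[x]" u] by (cases x) (simp add: gen_eq)
  qed (simp add: word_class_Nil)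
  moreover have "fst ` set u \<subseteq> carrier G"
    using u(1) by (auto simp: free_product_words_def)
  ultimately show thesis using u by (intro that) auto
qed

lemma FR_norm_le:
  assumes "set cs \<subseteq> conj_factors G"
  shows "FR_norm G N (conj_prod G cs) \<le> conj_cost N cs"
  unfolding FR_norm_def
proof (rule cInf_lower)
  show "bdd_below {conj_cost N ds |ds. set ds \<subseteq> conj_factors G \<and> conj_prod G cs = conj_prod G ds}"
    by (rule bdd_belowI[of _ 0]) (use conj_cost_nonneg in blast)
qed (use assms in auto)

lemma FR_norm_greatest:
  assumes "x \<in> carrier (FR G)"
    and "\<And>cs. \<lbrakk>set cs \<subseteq> conj_factors G; x = conj_prod G cs\<rbrakk> \<Longrightarrow> c \<le> conj_cost N cs"
  shows "c \<le> FR_norm G N x"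
proof -
  obtain cs where "set cs \<subseteq> conj_factors G" "x = conj_prod G cs"
    using assms(1) by (rule FR_is_conj_prod)
  then show ?thesis unfolding FR_norm_def
    by (intro cInf_greatest) (use assms(2) in blast)+
qed

section \<open>Integral words are evaluated without increasing the norm\<close>

definition integral_word :: "('a \<times> real) list \<Rightarrow> bool"
  where "integral_word u \<longleftrightarrow> u \<in> fp.W \<and> snd ` set u \<subseteq> \<int>"

text \<open>This represents \<open>\<pi>\<close> on words with integral exponents, where the floor does nothing. On other words
  it is still multiplicative, but it does not respect the relations of the free product.\<close>

definition word_eval :: "('a \<times> real) list \<Rightarrow> 'a"
  where "word_eval u = foldr (\<lambda>(g, r) y. g [^] \<lfloor>r\<rfloor> \<otimes> y) u \<one>"

lemma integral_word_simps [simp]: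
  "integral_word []"
  "integral_word (x # u) \<longleftrightarrow> fst x \<in> carrier G \<and> snd x \<in> \<int> \<and> integral_word u"
  "integral_word (u @ v) \<longleftrightarrow> integral_word u \<and> integral_word v"
  by (auto simp: integral_word_def)

lemma integral_word_words [simp]: "integral_word u \<Longrightarrow> u \<in> fp.W"
  by (simp add: integral_word_def)

lemma integral_word_neg [simp]: "integral_word u \<Longrightarrow> integral_word (neg_word u)"
  by (induction u) auto

lemma word_eval_simps [simp]:
  "word_eval [] = \<one>" "word_eval ((g, r) # u) = g [^] \<lfloor>r\<rfloor> \<otimes> word_eval u"
  by (simp_all add: word_eval_def)

lemma word_eval_closed [simp]: "u \<in> fp.W \<Longrightarrow> word_eval u \<in> carrier G"
  by (induction u) auto

lemma word_eval_append:
  "\<lbrakk>u \<in> fp.W; v \<in> fp.W\<rbrakk> \<Longrightarrow> word_eval (u @ v) = word_eval u \<otimes> word_eval v"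
  by (induction u) (auto simp: m_assoc)

lemma word_eval_neg: "integral_word u \<Longrightarrow> word_eval (neg_word u) = inv word_eval u"
proof (induction u)
  case (Cons x u)
  then show ?case
    by (cases x) (auto simp: word_eval_append inv_mult_group int_pow_neg elim!: Ints_cases)
qed simp

lemma norm_one: "N \<one> = 0"
  by (simp add: norm_eq_0_iff)

lemma norm_int_pow:
  assumes g: "g \<in> carrier G"
  shows "N (g [^] (n :: int)) \<le> \<bar>of_int n\<bar> * N g"
proof -
  have nat: "N (g [^] (k :: nat)) \<le> of_nat k * N g" for k
  proof (induction k)
    case (Suc k)
    have "N (g [^] Suc k) \<le> N (g [^] k) + N g" using g norm_triangle by simp
    then show ?case using Suc by (simp add: distrib_right)
  qed (simp add: norm_one)
  show ?thesis
  proof (cases n rule: int_cases2)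
    case (nonneg k)
    then show ?thesis using nat[of k] by (simp add: int_pow_int)
  next
    case (nonpos k)
    then show ?thesis using nat[of k] g by (simp add: int_pow_neg_int norm_inv)
  qed
qed

text \<open>Removing a factor from a product changes it by a conjugate of that factor.\<close>

lemma norm_insert_factor:
  assumes "a \<in> carrier G" "x \<in> carrier G" "b \<in> carrier G"
  shows "N (a \<otimes> (x \<otimes> b)) \<le> N (a \<otimes> b) + N x"
proof -
  have "inv a \<otimes> (a \<otimes> b) = b"
    using assms by (simp flip: m_assoc)
  then have "a \<otimes> (x \<otimes> b) = (a \<otimes> x \<otimes> inv a) \<otimes> (a \<otimes> b)"
    using assms by (simp add: m_assoc)
  then have "N (a \<otimes> (x \<otimes> b)) \<le> N (a \<otimes> x \<otimes> inv a) + N (a \<otimes> b)"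
    using assms norm_triangle by simp
  then show ?thesis using assms norm_conj by simp
qed

lemma norm_word_eval_le_deletion_cost:
  assumes "deletable wt u c" "integral_word u"
  shows "N (word_eval u) \<le> c"
  using assms
proof (induction rule: deletable.induct)
  case (nil c)
  then show ?case by (simp add: norm_one)
next
  case (delete u v c r g c')
  then have g: "g \<in> carrier G" and r: "r \<in> \<int>" by auto
  have "N (word_eval (u @ (g, r) # v)) \<le> N (word_eval (u @ v)) + N (g [^] \<lfloor>r\<rfloor>)"
    using delete.prems norm_insert_factor by (simp add: word_eval_append)
  also have "N (g [^] \<lfloor>r\<rfloor>) \<le> \<bar>r\<bar> * wt g"
    using norm_int_pow[OF g, of "\<lfloor>r\<rfloor>"] r norm_nonneg[OF g] by (auto elim!: Ints_cases)
  finally show ?case using delete by simp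
next
  case (split u g a b v c)
  then have "word_eval (u @ (g, a) # (g, b) # v) = word_eval (u @ (g, a + b) # v)"
    by (auto simp: word_eval_append int_pow_mult m_assoc elim!: Ints_cases
        simp flip: of_int_add)
  then show ?case using split by auto
qed

text \<open>The element is given by an integral word and by a product of conjugates. The latter has a
  deletion cost, which is transferred to the integral word and bounds the norm of its value.\<close>

lemma norm_word_eval_le:
  assumes u: "integral_word u"
  shows "N (word_eval u) \<le> FR_norm G N (word_class u)"
proof (rule FR_norm_greatest)
  fix cs
  assume cs: "set cs \<subseteq> conj_factors G" and eq: "word_class u = conj_prod G cs"
  obtain w where w: "w \<in> fp.W" "conj_prod G cs = word_class w" "deletable wt w (conj_cost wt cs)"
    using conj_prod_deletable[OF cs] by blast
  then have "(u, w) \<in> fp.rel" using eq u by (simp add: fp.words.class_eq_iff)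
  then have "deletable wt u (conj_cost wt cs)"
    using deletable_rel[of u w "carrier G" wt] w(3) by simp
  then show "N (word_eval u) \<le> conj_cost N cs"
    using norm_word_eval_le_deletion_cost u conj_cost_wt[OF cs] by simp
qed (use u in simp)

text \<open>As \<open>N\<close> is a norm, this includes that equivalent integral words have the same value.\<close>

lemma word_eval_eq:
  assumes u: "integral_word u" and v: "integral_word v" and eq: "word_class u = word_class v"
  shows "word_eval u = word_eval v"
proof -
  have "word_class (neg_word v @ u) = conj_prod G []"
    using assms by (simp add: word_class_append word_class_neg)
  then have "FR_norm G N (word_class (neg_word v @ u)) \<le> 0"
    using FR_norm_le[of "[]"] by simp
  then have "N (word_eval (neg_word v @ u)) \<le> 0"
    using norm_word_eval_le[of "neg_word v @ u"] u v by simp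
  then have "inv word_eval v \<otimes> word_eval u = \<one>"
    using norm_nonneg[of "inv word_eval v \<otimes> word_eval u"] norm_eq_0_iff u v
    by (simp add: word_eval_append word_eval_neg)
  then have "inv word_eval u = inv word_eval v"
    using u v by (intro inv_equality) auto
  then show ?thesis
    using u v by (metis integral_word_words inv_inv word_eval_closed)
qed


section \<open>The homomorphisms $\pi$ and $\psi_t$\<close>

lemma FZ_closed: "x \<in> carrier (FZ G) \<Longrightarrow> x \<in> carrier (FR G)"
  unfolding FZ_def using FR.carrier_subgroup_generated_subset by blast

lemma group_FZ: "group (FZ G)"
  by (simp add: FZ_def)

lemma mult_FZ [simp]: "(\<otimes>\<^bsub>FZ G\<^esub>) = (\<otimes>\<^bsub>FR G\<^esub>)" and one_FZ [simp]: "\<one>\<^bsub>FZ G\<^esub> = \<one>\<^bsub>FR G\<^esub>"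
  by (simp_all add: FZ_def)

lemma inv_FZ [simp]: "x \<in> carrier (FZ G) \<Longrightarrow> inv\<^bsub>FZ G\<^esub> x = inv\<^bsub>FR G\<^esub> x"
  by (simp add: FZ_def)

lemma FZ_induct [consumes 1, case_names one gen inv mult]:
  assumes "x \<in> carrier (FZ G)"
    and "P \<one>\<^bsub>FR G\<^esub>"
    and "\<And>g. g \<in> carrier G \<Longrightarrow> P (gen G g 1)"
    and "\<And>g. g \<in> carrier G \<Longrightarrow> P (inv\<^bsub>FR G\<^esub> gen G g 1)"
    and "\<And>x y. \<lbrakk>x \<in> carrier (FZ G); y \<in> carrier (FZ G); P x; P y\<rbrakk> \<Longrightarrow> P (x \<otimes>\<^bsub>FR G\<^esub> y)"
  shows "P x"
  using assms(1) unfolding FZ_def carrier_subgroup_generated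
  by (induction rule: generate.induct)
     (use assms(2-) in \<open>auto simp: FZ_def carrier_subgroup_generated\<close>)

lemma gen_in_FZ: "g \<in> carrier G \<Longrightarrow> gen G g 1 \<in> carrier (FZ G)"
  by (auto simp: FZ_def carrier_subgroup_generated intro!: generate.incl)

lemma FZ_cases:
  assumes "x \<in> carrier (FZ G)"
  obtains u where "integral_word u" "x = word_class u"
proof -
  have "\<exists>u. integral_word u \<and> x = word_class u"
    using assms
  proof (induction rule: FZ_induct)
    case one
    show ?case by (intro exI[of _ "[]"]) (simp add: word_class_Nil)
  next
    case (gen g)
    then show ?case by (intro exI[of _ "[(g, 1)]"]) (simp add: gen_eq)
  next
    case (inv g)
    then show ?case
      using gen_uminus[of g 1] by (intro exI[of _ "[(g, - 1)]"]) (simp add: gen_eq)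
  next
    case (mult x y)
    then obtain u v where "integral_word u" "x = word_class u" "integral_word v" "y = word_class v"
      by blast
    then show ?case by (intro exI[of _ "u @ v"]) (simp add: word_class_append)
  qed
  then show thesis using that by blast
qed

lemma hom_FZ_unique:
  assumes "group H" "\<phi> \<in> hom (FZ G) H" "\<psi> \<in> hom (FZ G) H"
    and eq: "\<And>g. g \<in> carrier G \<Longrightarrow> \<phi> (gen G g 1) = \<psi> (gen G g 1)"
    and x: "x \<in> carrier (FZ G)"
  shows "\<phi> x = \<psi> x"
proof -
  interpret \<phi>: group_hom "FZ G" H \<phi>
    by (intro group_homI group_FZ assms)
  interpret \<psi>: group_hom "FZ G" H \<psi>
    by (intro group_homI group_FZ assms)
  show ?thesis
    using x
  proof (induction rule: FZ_induct)
    case one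
    show ?case using \<phi>.hom_one \<psi>.hom_one by simp
  next
    case (gen g)
    then show ?case by (rule eq)
  next
    case (inv g)
    then show ?case
      using \<phi>.hom_inv[OF gen_in_FZ] \<psi>.hom_inv[OF gen_in_FZ] eq by (simp add: gen_in_FZ)
  next
    case (mult x y)
    then show ?case using \<phi>.hom_mult[of x y] \<psi>.hom_mult[of x y] by simp
  qed
qed

text \<open>That \<open>\<pi>\<close> exists, i.e. that \<open>F(G)\<close> is free, is the well-definedness of the evaluation of integral words.\<close>

lemma ex_eval_hom:
  obtains \<phi> where "\<phi> \<in> hom (FZ G) G" "\<phi> \<in> extensional (carrier (FZ G))"
    "\<And>u. \<lbrakk>integral_word u; word_class u \<in> carrier (FZ G)\<rbrakk> \<Longrightarrow> \<phi> (word_class u) = word_eval u"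
proof -
  define \<phi> where
    "\<phi> = (\<lambda>x\<in>carrier (FZ G). word_eval (SOME u. integral_word u \<and> x = word_class u))"
  have \<phi>: "\<phi> (word_class u) = word_eval u"
    if u: "integral_word u" and x: "word_class u \<in> carrier (FZ G)" for u
  proof -
    define v where "v = (SOME v. integral_word v \<and> word_class u = word_class v)"
    have "integral_word v \<and> word_class u = word_class v"
      unfolding v_def by (rule someI) (use u in simp)
    then have "word_eval v = word_eval u"
      by (intro word_eval_eq[OF _ u]) simp_all
    then show ?thesis using x by (simp add: \<phi>_def v_def)
  qed
  show thesis
  proof
    show "\<phi> \<in> hom (FZ G) G"
    proof (rule homI)
      fix x y assume x: "x \<in> carrier (FZ G)" and y: "y \<in> carrier (FZ G)"
      obtain u where u: "integral_word u" "x = word_class u" using x by (rule FZ_cases)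
      obtain v where v: "integral_word v" "y = word_class v" using y by (rule FZ_cases)
      have "x \<otimes>\<^bsub>FZ G\<^esub> y \<in> carrier (FZ G)"
        by (rule monoid.m_closed[OF group.is_monoid[OF group_FZ] x y])
      moreover have "x \<otimes>\<^bsub>FZ G\<^esub> y = word_class (u @ v)"
        using u v by (simp add: word_class_append)
      ultimately show "\<phi> (x \<otimes>\<^bsub>FZ G\<^esub> y) = \<phi> x \<otimes> \<phi> y"
        using u v x y \<phi> by (simp add: word_eval_append)
      show "\<phi> x \<in> carrier G" using u x \<phi> by simp
    qed
    show "\<phi> \<in> extensional (carrier (FZ G))" by (simp add: \<phi>_def)
  qed (rule \<phi>)
qed

lemma eval_hom_eqI:
  assumes "\<phi> \<in> hom (FZ G) G" "\<phi> \<in> extensional (carrier (FZ G))"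
    and "\<And>g. g \<in> carrier G \<Longrightarrow> \<phi> (gen G g 1) = g"
  shows "eval_hom G = \<phi>"
  unfolding eval_hom_def
proof (rule the_equality)
  fix \<psi>
  assume "\<psi> \<in> hom (FZ G) G \<and> \<psi> \<in> extensional (carrier (FZ G)) \<and>
    (\<forall>g\<in>carrier G. \<psi> (gen G g 1) = g)"
  then show "\<psi> = \<phi>"
    using assms hom_FZ_unique[OF is_group, of \<psi> \<phi>] by (intro extensionalityI[of _ "carrier (FZ G)"]) auto
qed (use assms in auto)

lemma eval_hom_hom: "eval_hom G \<in> hom (FZ G) G"
  and eval_hom_word_class:
    "\<lbrakk>integral_word u; word_class u \<in> carrier (FZ G)\<rbrakk> \<Longrightarrow> eval_hom G (word_class u) = word_eval u"
proof -
  obtain \<phi> where \<phi>: "\<phi> \<in> hom (FZ G) G" "\<phi> \<in> extensional (carrier (FZ G))"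
    and val: "\<And>u. \<lbrakk>integral_word u; word_class u \<in> carrier (FZ G)\<rbrakk> \<Longrightarrow> \<phi> (word_class u) = word_eval u"
    using ex_eval_hom by blast
  have "\<phi> (gen G g 1) = g" if "g \<in> carrier G" for g
    using val[of "[(g, 1)]"] gen_in_FZ[OF that] that by (simp add: gen_eq)
  then have "eval_hom G = \<phi>" by (intro eval_hom_eqI \<phi>)
  then show "eval_hom G \<in> hom (FZ G) G"
    "\<lbrakk>integral_word u; word_class u \<in> carrier (FZ G)\<rbrakk> \<Longrightarrow> eval_hom G (word_class u) = word_eval u"
    using \<phi> val by auto
qed

lemma norm_eval_hom_le:
  assumes x: "x \<in> carrier (FZ G)"
  shows "N (eval_hom G x) \<le> FR_norm G N x"
proof -
  obtain u where "integral_word u" "x = word_class u" using x by (rule FZ_cases)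
  then show ?thesis using x norm_word_eval_le by (simp add: eval_hom_word_class)
qed

lemma hom_FR_unique:
  assumes "group H" "\<phi> \<in> hom (FR G) H" "\<psi> \<in> hom (FR G) H"
    and "\<And>g r. g \<in> carrier G \<Longrightarrow> \<phi> (gen G g r) = \<psi> (gen G g r)" and "x \<in> carrier (FR G)"
  shows "\<phi> x = \<psi> x"
  using assms unfolding FR_def gen_def by (intro fp.hom_eq_on_free_product[of H \<phi> \<psi> x]) auto

text \<open>The universal property of the free product provides \<open>\<psi>\<^sub>t\<close>.\<close>

lemma scale_hom_hom: "scale_hom G t \<in> hom (FR G) (FR G)"
  and scale_hom_gen: "g \<in> carrier G \<Longrightarrow> scale_hom G t (gen G g r) = gen G g (t * r)"
proof -
  let ?P = "\<lambda>\<phi>. \<phi> \<in> hom (FR G) (FR G) \<and> \<phi> \<in> extensional (carrier (FR G)) \<and>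
    (\<forall>g\<in>carrier G. \<forall>r. \<phi> (gen G g r) = gen G g (t * r))"
  have "(\<lambda>r. gen G g (t * r)) \<in> hom real_group (FR G)" if "g \<in> carrier G" for g
    using that by (intro homI) (simp_all add: gen_add distrib_left)
  from fp.free_product_lift[where f = "\<lambda>g r. gen G g (t * r)", OF FR.is_group this]
  obtain \<phi> where \<phi>: "\<phi> \<in> hom (FR G) (FR G)"
    "\<And>g r. g \<in> carrier G \<Longrightarrow> \<phi> (gen G g r) = gen G g (t * r)"
    by (auto simp: FR_def gen_def)
  have "\<exists>!\<phi>. ?P \<phi>"
  proof (rule ex1I)
    show "?P (restrict \<phi> (carrier (FR G)))"
      using \<phi> by (auto simp: hom_def)
    fix \<psi> assume \<psi>: "?P \<psi>"
    show "\<psi> = restrict \<phi> (carrier (FR G))"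
      using \<psi> \<phi> hom_FR_unique[OF FR.is_group, of \<psi> \<phi>]
      by (intro extensionalityI[of _ "carrier (FR G)"]) auto
  qed
  from theI'[OF this] show "scale_hom G t \<in> hom (FR G) (FR G)"
    "g \<in> carrier G \<Longrightarrow> scale_hom G t (gen G g r) = gen G g (t * r)"
    by (auto simp: scale_hom_def)
qed

lemma scale_hom_closed [simp]: "x \<in> carrier (FR G) \<Longrightarrow> scale_hom G t x \<in> carrier (FR G)"
  using scale_hom_hom[of t] by (auto simp: hom_def)

lemma scale_hom_inverse:
  assumes "t * s = 1" and x: "x \<in> carrier (FR G)"
  shows "scale_hom G t (scale_hom G s x) = x"
proof -
  have comp: "scale_hom G t \<circ> scale_hom G s \<in> hom (FR G) (FR G)"
    using Group.hom_compose[OF scale_hom_hom scale_hom_hom] .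
  have id: "(\<lambda>x. x) \<in> hom (FR G) (FR G)"
    by (rule homI) auto
  have "(scale_hom G t \<circ> scale_hom G s) x = (\<lambda>x. x) x"
    by (rule hom_FR_unique[OF FR.is_group comp id _ x])
       (simp add: scale_hom_gen assms(1) flip: mult.assoc)
  then show ?thesis by simp
qed

lemma FR_norm_scale_hom_le:
  assumes x: "x \<in> carrier (FR G)" and t: "0 < t"
  shows "FR_norm G N (scale_hom G t x) \<le> t * FR_norm G N x"
proof -
  interpret \<psi>: group_hom "FR G" "FR G" "scale_hom G t"
    by (intro group_homI FR.is_group scale_hom_hom)
  have "FR_norm G N (scale_hom G t x) / t \<le> FR_norm G N x"
  proof (rule FR_norm_greatest[OF x])
    fix cs assume cs: "set cs \<subseteq> conj_factors G" "x = conj_prod G cs"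
    define ds where "ds = map (\<lambda>(h, g, r, e). (scale_hom G t h, g, t * r, e)) cs"
    have ds: "set ds \<subseteq> conj_factors G" using cs(1) by (auto simp: ds_def)
    have "scale_hom G t (conj_prod G cs) = conj_prod G ds"
      using cs(1) unfolding ds_def
    proof (induction cs)
      case (Cons c cs)
      then show ?case
        by (cases c) (auto simp: scale_hom_gen gen_sign_power mult.left_commute)
    qed simp
    then have "FR_norm G N (scale_hom G t x) \<le> conj_cost N ds"
      using FR_norm_le[OF ds] cs(2) by simp
    also have "conj_cost N ds = t * conj_cost N cs"
      using t by (simp add: ds_def o_def case_prod_unfold abs_mult mult.assoc sum_list_const_mult)
    finally show "FR_norm G N (scale_hom G t x) / t \<le> conj_cost N cs"
      using t by (simp add: divide_le_eq mult.commute)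
  qed
  then show ?thesis using t by (simp add: divide_le_eq mult.commute)
qed

text \<open>The element is \<open>\<psi>\<^sub>t\<close> of its own rescaling, and \<open>\<psi>\<^sub>t\<close> multiplies norms by at most \<open>t\<close>.\<close>

lemma norm_eval_hom_le_scaled:
  assumes x: "x \<in> carrier (FZ G)" and t: "0 < t"
  shows "N (eval_hom G x) / t \<le> FR_norm G N (scale_hom G (1 / t) x)"
proof -
  have "N (eval_hom G x) \<le> FR_norm G N (scale_hom G t (scale_hom G (1 / t) x))"
    using norm_eval_hom_le[OF x] scale_hom_inverse[of t "1 / t" x] t FZ_closed[OF x] by simp
  also have "\<dots> \<le> t * FR_norm G N (scale_hom G (1 / t) x)"
    by (intro FR_norm_scale_hom_le t) (simp add: FZ_closed[OF x])
  finally show ?thesis using t by (simp add: divide_le_eq mult.commute)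
qed

end

section \<open>Conjugation-invariant pseudonorms\<close>

locale conj_inv_pseudonormed_group = group H for H (structure) +
  fixes M :: "'b \<Rightarrow> real"
  assumes pn_nonneg: "x \<in> carrier H \<Longrightarrow> 0 \<le> M x"
    and pn_one: "M \<one> = 0"
    and pn_inv: "x \<in> carrier H \<Longrightarrow> M (inv x) = M x"
    and pn_triangle: "\<lbrakk>x \<in> carrier H; y \<in> carrier H\<rbrakk> \<Longrightarrow> M (x \<otimes> y) \<le> M x + M y"
    and pn_conj: "\<lbrakk>x \<in> carrier H; h \<in> carrier H\<rbrakk> \<Longrightarrow> M (h \<otimes> x \<otimes> inv h) = M x"
begin

lemma pn_commute:
  assumes "x \<in> carrier H" "y \<in> carrier H" shows "M (x \<otimes> y) = M (y \<otimes> x)"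
proof -
  have "x \<otimes> y = x \<otimes> (y \<otimes> x) \<otimes> inv x" using assms by (simp add: m_assoc)
  then show ?thesis using pn_conj assms by simp
qed

lemma dist_sym:
  assumes "x \<in> carrier H" "y \<in> carrier H" shows "M (inv x \<otimes> y) = M (inv y \<otimes> x)"
  using pn_inv[of "inv x \<otimes> y"] assms by (simp add: inv_mult_group)

lemma dist_inv:
  assumes "x \<in> carrier H" "y \<in> carrier H"
  shows "M (inv (inv x) \<otimes> inv y) = M (inv x \<otimes> y)"
  using assms pn_commute[of x "inv y"] dist_sym by simp

lemma dist_mult:
  assumes "x \<in> carrier H" "y \<in> carrier H" "x' \<in> carrier H" "y' \<in> carrier H"
  shows "M (inv (x \<otimes> y) \<otimes> (x' \<otimes> y')) \<le> M (inv x \<otimes> x') + M (inv y \<otimes> y')"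
proof -
  have "y \<otimes> (inv y \<otimes> y') = y'"
    using assms by (simp flip: m_assoc)
  then have "inv (x \<otimes> y) \<otimes> (x' \<otimes> y') = inv y \<otimes> (inv x \<otimes> x') \<otimes> inv (inv y) \<otimes> (inv y \<otimes> y')"
    using assms by (simp add: inv_mult_group m_assoc)
  also have "M \<dots> \<le> M (inv y \<otimes> (inv x \<otimes> x') \<otimes> inv (inv y)) + M (inv y \<otimes> y')"
    using assms by (intro pn_triangle) auto
  also have "M (inv y \<otimes> (inv x \<otimes> x') \<otimes> inv (inv y)) = M (inv x \<otimes> x')"
    using assms by (intro pn_conj) auto
  finally show ?thesis by simp
qed

lemma pn_diff_le_dist:
  assumes x: "x \<in> carrier H" and y: "y \<in> carrier H"
  shows "\<bar>M x - M y\<bar> \<le> M (inv x \<otimes> y)"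
proof -
  have le: "M b \<le> M a + M (inv a \<otimes> b)" if "a \<in> carrier H" "b \<in> carrier H" for a b
  proof -
    have "M (a \<otimes> (inv a \<otimes> b)) \<le> M a + M (inv a \<otimes> b)"
      using that by (intro pn_triangle) auto
    then show ?thesis using that by (simp flip: m_assoc)
  qed
  show ?thesis using le[OF x y] le[OF y x] dist_sym[OF x y] by linarith
qed

subsection \<open>The quotient by the elements of pseudonorm zero\<close>

text \<open>The directional cone is the quotient by a normal subgroup, the ultrafilter cone the quotient by a
  congruence. Both identify elements at distance zero for a pseudonorm.\<close>

definition null_set where "null_set = {x \<in> carrier H. M x = 0}"

definition null_rel where
  "null_rel = {(x, y). x \<in> carrier H \<and> y \<in> carrier H \<and> M (inv x \<otimes> y) = 0}"

lemma null_rel_pn_eq: "(x, y) \<in> null_rel \<Longrightarrow> M x = M y"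
  using pn_diff_le_dist by (fastforce simp: null_rel_def)

lemma null_rel_congruence: "monoid_congruence H null_rel"
proof (intro monoid_congruence.intro monoid_congruence_axioms.intro)
  show "equiv (carrier H) null_rel"
  proof (rule equivI)
    show "null_rel \<subseteq> carrier H \<times> carrier H" by (auto simp: null_rel_def)
    show "refl_on (carrier H) null_rel" by (auto simp: refl_on_def null_rel_def pn_one)
    show "sym null_rel" by (auto simp: sym_def null_rel_def dist_sym)
    show "trans null_rel"
    proof (rule transI)
      fix x y z assume "(x, y) \<in> null_rel" "(y, z) \<in> null_rel"
      then have xyz: "x \<in> carrier H" "y \<in> carrier H" "z \<in> carrier H"
        and 0: "M (inv x \<otimes> y) = 0" "M (inv y \<otimes> z) = 0"
        by (auto simp: null_rel_def)
      have "y \<otimes> (inv y \<otimes> z) = z" using xyz by (simp flip: m_assoc)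
      then have "M (inv x \<otimes> z) \<le> M (inv x \<otimes> y) + M (inv y \<otimes> z)"
        using pn_triangle[of "inv x \<otimes> y" "inv y \<otimes> z"] xyz by (simp add: m_assoc)
      then have "M (inv x \<otimes> z) = 0"
        using pn_nonneg[of "inv x \<otimes> z"] xyz 0 by simp
      then show "(x, z) \<in> null_rel" using xyz by (simp add: null_rel_def)
    qed
  qed
  fix x x' y y' assume *: "(x, x') \<in> null_rel" "(y, y') \<in> null_rel"
  then have "M (inv (x \<otimes> y) \<otimes> (x' \<otimes> y')) \<le> 0"
    using dist_mult[of x y x' y'] by (simp add: null_rel_def)
  moreover have "0 \<le> M (inv (x \<otimes> y) \<otimes> (x' \<otimes> y'))"
    using * by (intro pn_nonneg) (simp add: null_rel_def)
  ultimately show "(x \<otimes> y, x' \<otimes> y') \<in> null_rel"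
    using * by (simp add: null_rel_def)
qed (rule monoid_axioms)

lemma group_quotient_null_rel: "group (quotient_monoid H null_rel)"
proof (rule monoid_congruence.group_quotient[OF null_rel_congruence])
  fix x assume "x \<in> carrier H"
  then show "\<exists>y\<in>carrier H. (y \<otimes> x, \<one>) \<in> null_rel"
    by (intro bexI[of _ "inv x"]) (simp_all add: null_rel_def pn_one)
qed

lemma subgroup_null_set: "subgroup null_set H"
proof (rule subgroupI)
  show "null_set \<noteq> {}" using pn_one by (auto simp: null_set_def)
  fix a b assume ab: "a \<in> null_set" "b \<in> null_set"
  then have "M (a \<otimes> b) \<le> 0" "0 \<le> M (a \<otimes> b)"
    using pn_triangle[of a b] pn_nonneg[of "a \<otimes> b"] by (auto simp: null_set_def)
  then show "a \<otimes> b \<in> null_set" using ab by (auto simp: null_set_def)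
qed (auto simp: null_set_def pn_inv)

lemma normal_null_set: "null_set \<lhd> H"
  using subgroup_null_set by (auto simp: normal_inv_iff null_set_def pn_conj)

lemma pn_image_coset:
  assumes x: "x \<in> carrier H" shows "M ` (null_set #> x) = {M x}"
proof -
  have "M (n \<otimes> x) = M x" if n: "n \<in> carrier H" "M n = 0" for n
  proof -
    have "\<bar>M x - M (n \<otimes> x)\<bar> \<le> M (inv x \<otimes> n \<otimes> inv (inv x))"
      using pn_diff_le_dist[of x "n \<otimes> x"] x n by (simp add: m_assoc)
    also have "\<dots> = 0" using pn_conj[of n "inv x"] x n by simp
    finally show ?thesis by simp
  qed
  then have "M y = M x" if "y \<in> null_set #> x" for y
    using that by (auto simp: r_coset_def null_set_def)
  moreover have "x \<in> null_set #> x"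
    by (rule rcos_self[OF x subgroup_null_set])
  ultimately show ?thesis by blast
qed

lemma pn_image_class:
  assumes "x \<in> carrier H" shows "M ` (null_rel `` {x}) = {M x}"
proof -
  have "x \<in> null_rel `` {x}" using assms by (simp add: null_rel_def pn_one)
  moreover have "M y = M x" if "y \<in> null_rel `` {x}" for y
    using that null_rel_pn_eq by force
  ultimately show ?thesis by blast
qed

end

subsection \<open>Constructions of pseudonorms\<close>

text \<open>Both cones carry limits of rescaled norms: over \<open>t \<rightarrow> \<infinity>\<close> for functions on \<open>T\<close>, and along the ultrafilter
  for sequences. For fixed \<open>t\<close>, respectively fixed \<open>n\<close>, these norms are pulled back along a homomorphism
  and rescaled.\<close>

lemma pseudonorm_pullback:
  assumes "group_hom K H \<phi>" "conj_inv_pseudonormed_group H M"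
  shows "conj_inv_pseudonormed_group K (\<lambda>x. M (\<phi> x))"
proof -
  interpret \<phi>: group_hom K H \<phi> by fact
  interpret conj_inv_pseudonormed_group H M by fact
  show ?thesis
    by unfold_locales (simp_all add: pn_nonneg pn_one pn_inv pn_triangle pn_conj)
qed

lemma pseudonorm_divide:
  assumes "conj_inv_pseudonormed_group H M" and c: "0 < (c :: real)"
  shows "conj_inv_pseudonormed_group H (\<lambda>x. M x / c)"
proof -
  interpret conj_inv_pseudonormed_group H M by fact
  show ?thesis
    by unfold_locales
       (use c pn_triangle in \<open>simp_all add: pn_nonneg pn_one pn_inv pn_conj divide_right_mono
          flip: add_divide_distrib\<close>)
qed

text \<open>The axioms of a pseudonorm are equations and weak inequalities, hence survive the limit.\<close>

lemma pseudonorm_limit: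
  assumes "F \<noteq> bot" and H: "group H"
    and lim: "\<And>x. x \<in> carrier H \<Longrightarrow> ((\<lambda>t. \<nu> t x) \<longlongrightarrow> M x) F"
    and pn: "\<forall>\<^sub>F t in F. conj_inv_pseudonormed_group H (\<nu> t)"
  shows "conj_inv_pseudonormed_group H M"
proof -
  interpret group H by fact
  note ev = eventually_mono[OF pn]
  note pn = conj_inv_pseudonormed_group.pn_nonneg conj_inv_pseudonormed_group.pn_one
    conj_inv_pseudonormed_group.pn_inv conj_inv_pseudonormed_group.pn_triangle
    conj_inv_pseudonormed_group.pn_conj
  have eqI: "M x = M y"
    if "x \<in> carrier H" "y \<in> carrier H"
      and "\<And>t. conj_inv_pseudonormed_group H (\<nu> t) \<Longrightarrow> \<nu> t x = \<nu> t y" for x y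
  proof -
    have "((\<lambda>t. \<nu> t x) \<longlongrightarrow> M y) F"
      by (rule Lim_transform_eventually[OF lim[OF that(2)]]) (rule ev, simp add: that(3))
    then show ?thesis
      using tendsto_unique[OF \<open>F \<noteq> bot\<close> lim[OF that(1)]] by blast
  qed
  show ?thesis
  proof
    fix x assume x: "x \<in> carrier H"
    show "0 \<le> M x"
      by (rule tendsto_lowerbound[OF lim[OF x] ev \<open>F \<noteq> bot\<close>]) (use x in \<open>simp add: pn(1)\<close>)
    show "M (inv\<^bsub>H\<^esub> x) = M x" using x by (intro eqI) (simp_all add: pn)
    fix y assume y: "y \<in> carrier H"
    show "M (x \<otimes>\<^bsub>H\<^esub> y) \<le> M x + M y"
      by (rule tendsto_le[OF \<open>F \<noteq> bot\<close> tendsto_add[OF lim[OF x] lim[OF y]] lim ev])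
         (use x y in \<open>simp_all add: pn\<close>)
    show "M (y \<otimes>\<^bsub>H\<^esub> x \<otimes>\<^bsub>H\<^esub> inv\<^bsub>H\<^esub> y) = M x"
      using x y by (intro eqI) (simp_all add: pn)
  next
    have "((\<lambda>t. \<nu> t \<one>\<^bsub>H\<^esub>) \<longlongrightarrow> 0) F"
      by (rule tendsto_eventually) (rule ev, simp add: pn)
    then show "M \<one>\<^bsub>H\<^esub> = 0"
      using tendsto_unique[OF \<open>F \<noteq> bot\<close> lim[OF one_closed]] by blast
  qed
qed

text \<open>The quotient pseudonorm along a surjective homomorphism. The infimum of the pseudonorms of
  the preimages behaves well because preimages may be multiplied, inverted and conjugated.\<close>

definition pushforward_pn ::
    "('c, 'k) monoid_scheme \<Rightarrow> ('c \<Rightarrow> real) \<Rightarrow> ('c \<Rightarrow> 'b) \<Rightarrow> 'b \<Rightarrow> real"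
  where "pushforward_pn K M \<phi> y = Inf {M x | x. x \<in> carrier K \<and> \<phi> x = y}"

lemma pushforward_pn_le:
  assumes "conj_inv_pseudonormed_group K M" "x \<in> carrier K"
  shows "pushforward_pn K M \<phi> (\<phi> x) \<le> M x"
  unfolding pushforward_pn_def
proof (rule cInf_lower)
  show "bdd_below {M z |z. z \<in> carrier K \<and> \<phi> z = \<phi> x}"
    by (rule bdd_belowI[of _ 0]) (use conj_inv_pseudonormed_group.pn_nonneg[OF assms(1)] in auto)
qed (use assms(2) in auto)

lemma pushforward_pn_greatest:
  assumes "y \<in> \<phi> ` carrier K" "\<And>x. \<lbrakk>x \<in> carrier K; \<phi> x = y\<rbrakk> \<Longrightarrow> c \<le> M x"
  shows "c \<le> pushforward_pn K M \<phi> y"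
  unfolding pushforward_pn_def using assms by (intro cInf_greatest) auto

lemma pseudonorm_pushforward:
  assumes "conj_inv_pseudonormed_group K M" "group_hom K H \<phi>" and surj: "\<phi> ` carrier K = carrier H"
  shows "conj_inv_pseudonormed_group H (pushforward_pn K M \<phi>)"
proof -
  interpret K: conj_inv_pseudonormed_group K M by fact
  interpret \<phi>: group_hom K H \<phi> by fact
  note le = pushforward_pn_le[OF assms(1), of _ \<phi>]
  note ge = pushforward_pn_greatest[of _ \<phi> K _ M, unfolded surj]
  have inv_le: "pushforward_pn K M \<phi> (inv\<^bsub>H\<^esub> y) \<le> pushforward_pn K M \<phi> y"
    if y: "y \<in> carrier H" for y
  proof (rule ge[OF y])
    fix x assume "x \<in> carrier K" "\<phi> x = y"
    then show "pushforward_pn K M \<phi> (inv\<^bsub>H\<^esub> y) \<le> M x"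
      using le[of "inv\<^bsub>K\<^esub> x"] K.pn_inv by simp
  qed
  have conj_le: "pushforward_pn K M \<phi> (h \<otimes>\<^bsub>H\<^esub> y \<otimes>\<^bsub>H\<^esub> inv\<^bsub>H\<^esub> h) \<le> pushforward_pn K M \<phi> y"
    if y: "y \<in> carrier H" and h: "h \<in> carrier H" for y h
  proof (rule ge[OF y])
    fix x assume x: "x \<in> carrier K" "\<phi> x = y"
    from h obtain k where "h = \<phi> k" "k \<in> carrier K" unfolding surj[symmetric] by (rule imageE)
    then show "pushforward_pn K M \<phi> (h \<otimes>\<^bsub>H\<^esub> y \<otimes>\<^bsub>H\<^esub> inv\<^bsub>H\<^esub> h) \<le> M x"
      using le[of "k \<otimes>\<^bsub>K\<^esub> x \<otimes>\<^bsub>K\<^esub> inv\<^bsub>K\<^esub> k"] K.pn_conj x by simp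
  qed
  show ?thesis
  proof
    fix y assume y: "y \<in> carrier H"
    show nonneg: "0 \<le> pushforward_pn K M \<phi> y"
      by (rule ge[OF y]) (rule K.pn_nonneg)
    show "pushforward_pn K M \<phi> (inv\<^bsub>H\<^esub> y) = pushforward_pn K M \<phi> y"
      using inv_le[of y] inv_le[of "inv\<^bsub>H\<^esub> y"] y by simp
    fix z assume z: "z \<in> carrier H"
    have "pushforward_pn K M \<phi> (y \<otimes>\<^bsub>H\<^esub> z) - pushforward_pn K M \<phi> z \<le> pushforward_pn K M \<phi> y"
    proof (rule ge[OF y])
      fix x assume x: "x \<in> carrier K" "\<phi> x = y"
      have "pushforward_pn K M \<phi> (y \<otimes>\<^bsub>H\<^esub> z) - M x \<le> pushforward_pn K M \<phi> z"
      proof (rule ge[OF z])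
        fix x' assume x': "x' \<in> carrier K" "\<phi> x' = z"
        show "pushforward_pn K M \<phi> (y \<otimes>\<^bsub>H\<^esub> z) - M x \<le> M x'"
          using le[of "x \<otimes>\<^bsub>K\<^esub> x'"] K.pn_triangle[of x x'] x x' by simp
      qed
      then show "pushforward_pn K M \<phi> (y \<otimes>\<^bsub>H\<^esub> z) - pushforward_pn K M \<phi> z \<le> M x" by simp
    qed
    then show "pushforward_pn K M \<phi> (y \<otimes>\<^bsub>H\<^esub> z) \<le> pushforward_pn K M \<phi> y + pushforward_pn K M \<phi> z"
      by simp
    have "inv\<^bsub>H\<^esub> z \<otimes>\<^bsub>H\<^esub> (z \<otimes>\<^bsub>H\<^esub> y \<otimes>\<^bsub>H\<^esub> inv\<^bsub>H\<^esub> z) \<otimes>\<^bsub>H\<^esub> inv\<^bsub>H\<^esub> (inv\<^bsub>H\<^esub> z) = y"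
      using y z by (simp add: \<phi>.H.m_assoc \<phi>.H.inv_solve_left')
    then show "pushforward_pn K M \<phi> (z \<otimes>\<^bsub>H\<^esub> y \<otimes>\<^bsub>H\<^esub> inv\<^bsub>H\<^esub> z) = pushforward_pn K M \<phi> y"
      using conj_le[of y z] conj_le[of "z \<otimes>\<^bsub>H\<^esub> y \<otimes>\<^bsub>H\<^esub> inv\<^bsub>H\<^esub> z" "inv\<^bsub>H\<^esub> z"] y z by simp
  next
    have "pushforward_pn K M \<phi> \<one>\<^bsub>H\<^esub> \<le> 0" using le[of "\<one>\<^bsub>K\<^esub>"] K.pn_one by simp
    moreover have "0 \<le> pushforward_pn K M \<phi> \<one>\<^bsub>H\<^esub>"
      by (rule ge) (simp_all add: K.pn_nonneg)
    ultimately show "pushforward_pn K M \<phi> \<one>\<^bsub>H\<^esub> = 0" by simp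
  qed
qed


subsection \<open>Cauchy functions\<close>

lemma eventually_at_top_in:
  "eventually P (at_top_in T) \<longleftrightarrow> (\<exists>s. \<forall>t\<in>T. s \<le> t \<longrightarrow> P t)"
  by (auto simp: at_top_in_def eventually_inf_principal eventually_at_top_linorder)

lemma eventually_at_top_in_mem: "(\<And>t. t \<in> T \<Longrightarrow> P t) \<Longrightarrow> eventually P (at_top_in T)"
  by (auto simp: eventually_at_top_in)

lemma at_top_in_neq_bot:
  assumes "scaling_set T" shows "at_top_in T \<noteq> bot"
proof
  assume "at_top_in T = bot"
  then obtain s where s: "\<forall>t\<in>T. t < s"
    using eventually_at_top_in[of "\<lambda>_. False" T] by (auto simp: not_le)
  have "bounded T"
    by (rule boundedI[of _ s]) (use s assms in \<open>force simp: scaling_set_def\<close>)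
  then show False using assms by (simp add: scaling_set_def)
qed

lemma cauchy_on_cong:
  "(\<And>t. t \<in> T \<Longrightarrow> f t = g t) \<Longrightarrow> cauchy_on T D f \<longleftrightarrow> cauchy_on T D g"
  by (simp add: cauchy_on_def)

context conj_inv_pseudonormed_group
begin

lemma cauchy_on_const_one: "cauchy_on T (norm_dist H M) (\<lambda>_. \<one>)"
  by (auto simp: cauchy_on_def norm_dist_def pn_one)

lemma cauchy_on_inv:
  assumes "cauchy_on T (norm_dist H M) f" "f ` T \<subseteq> carrier H"
  shows "cauchy_on T (norm_dist H M) (\<lambda>t. inv (f t))"
  unfolding cauchy_on_def
proof (intro allI impI)
  fix \<epsilon> :: real assume "0 < \<epsilon>"
  then obtain s where s: "\<forall>t\<in>T. \<forall>t'\<in>T. s \<le> t \<longrightarrow> s \<le> t' \<longrightarrow> norm_dist H M (f t) (f t') < \<epsilon>"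
    using assms(1) unfolding cauchy_on_def by blast
  have "norm_dist H M (inv (f t)) (inv (f t')) = norm_dist H M (f t) (f t')"
    if "t \<in> T" "t' \<in> T" for t t'
    using that assms(2) unfolding norm_dist_def by (intro dist_inv) auto
  with s show "\<exists>s. \<forall>t\<in>T. \<forall>t'\<in>T. s \<le> t \<longrightarrow> s \<le> t' \<longrightarrow> norm_dist H M (inv (f t)) (inv (f t')) < \<epsilon>"
    by auto
qed

lemma cauchy_on_mult:
  assumes "cauchy_on T (norm_dist H M) f" "cauchy_on T (norm_dist H M) g"
    and sub: "f ` T \<subseteq> carrier H" "g ` T \<subseteq> carrier H"
  shows "cauchy_on T (norm_dist H M) (\<lambda>t. f t \<otimes> g t)"
  unfolding cauchy_on_def
proof (intro allI impI)
  fix \<epsilon> :: real assume "0 < \<epsilon>"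
  then have e: "0 < \<epsilon> / 2" by simp
  obtain s where s: "\<forall>t\<in>T. \<forall>t'\<in>T. s \<le> t \<longrightarrow> s \<le> t' \<longrightarrow> norm_dist H M (f t) (f t') < \<epsilon> / 2"
    using assms(1) e unfolding cauchy_on_def by blast
  obtain s' where s': "\<forall>t\<in>T. \<forall>t'\<in>T. s' \<le> t \<longrightarrow> s' \<le> t' \<longrightarrow> norm_dist H M (g t) (g t') < \<epsilon> / 2"
    using assms(2) e unfolding cauchy_on_def by blast
  show "\<exists>s. \<forall>t\<in>T. \<forall>t'\<in>T. s \<le> t \<longrightarrow> s \<le> t' \<longrightarrow> norm_dist H M (f t \<otimes> g t) (f t' \<otimes> g t') < \<epsilon>"
  proof (intro exI[of _ "max s s'"] ballI impI)
    fix t t' assume t: "t \<in> T" "t' \<in> T" "max s s' \<le> t" "max s s' \<le> t'"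
    have "norm_dist H M (f t \<otimes> g t) (f t' \<otimes> g t') \<le> norm_dist H M (f t) (f t') + norm_dist H M (g t) (g t')"
      unfolding norm_dist_def using t sub by (intro dist_mult) auto
    also have "\<dots> < \<epsilon> / 2 + \<epsilon> / 2"
      using t s s' by (intro add_strict_mono) auto
    finally show "norm_dist H M (f t \<otimes> g t) (f t' \<otimes> g t') < \<epsilon>" by simp
  qed
qed

lemma cauchy_on_norm_converges:
  assumes "cauchy_on T (norm_dist H M) f" and sub: "f ` T \<subseteq> carrier H" and T: "scaling_set T"
  shows "((\<lambda>t. M (f t)) \<longlongrightarrow> Lim (at_top_in T) (\<lambda>t. M (f t))) (at_top_in T)"
proof -
  have "cauchy_filter (filtermap (\<lambda>t. M (f t)) (at_top_in T))"
    unfolding cauchy_filter_metric_filtermap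
  proof (intro allI impI)
    fix \<epsilon> :: real assume "0 < \<epsilon>"
    then obtain s where s: "\<forall>t\<in>T. \<forall>t'\<in>T. s \<le> t \<longrightarrow> s \<le> t' \<longrightarrow> norm_dist H M (f t) (f t') < \<epsilon>"
      using assms(1) unfolding cauchy_on_def by blast
    have "dist (M (f t)) (M (f t')) < \<epsilon>" if "t \<in> T \<and> s \<le> t" "t' \<in> T \<and> s \<le> t'" for t t'
    proof -
      have "\<bar>M (f t) - M (f t')\<bar> \<le> norm_dist H M (f t) (f t')"
        unfolding norm_dist_def using that sub by (intro pn_diff_le_dist) auto
      then show ?thesis using s that by (force simp: dist_real_def)
    qed
    then show "\<exists>P. eventually P (at_top_in T) \<and>
        (\<forall>x y. P x \<and> P y \<longrightarrow> dist (M (f x)) (M (f y)) < \<epsilon>)"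
      by (intro exI[of _ "\<lambda>t. t \<in> T \<and> s \<le> t"]) (auto simp: eventually_at_top_in)
  qed
  then have "\<exists>L. filtermap (\<lambda>t. M (f t)) (at_top_in T) \<le> nhds L"
    by (intro cauchy_filter_complete_converges[of _ UNIV])
       (auto simp: complete_UNIV filtermap_bot_iff at_top_in_neq_bot[OF T])
  then obtain L where "((\<lambda>t. M (f t)) \<longlongrightarrow> L) (at_top_in T)"
    by (auto simp: filterlim_def)
  then show ?thesis
    using tendsto_Lim[OF at_top_in_neq_bot[OF T]] by blast
qed

end

section \<open>The pseudonorm on $F_{\mathbb{R}}(G)$\<close>

context conj_inv_normed_group
begin

sublocale pn: conj_inv_pseudonormed_group G N
  by unfold_locales (simp_all add: norm_nonneg norm_one norm_inv norm_triangle norm_conj)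

lemma inv_conj_prod:
  assumes "set cs \<subseteq> conj_factors G"
  shows "inv\<^bsub>FR G\<^esub> conj_prod G cs = conj_prod G (rev (map (\<lambda>(h, g, r, e). (h, g, r, - e)) cs))"
  using assms
proof (induction cs)
  case (Cons c cs)
  obtain h g r e where c: "c = (h, g, r, e)" by (cases c)
  have sub: "set cs \<subseteq> conj_factors G" "set (rev (map (\<lambda>(h, g, r, e). (h, g, r, - e)) cs)) \<subseteq> conj_factors G"
    "set [(h, g, r, - e)] \<subseteq> conj_factors G"
    using Cons.prems by (auto simp: c)
  then show ?case
    using Cons
    by (simp add: c conj_prod_append[OF sub(2,3)] FR.inv_mult_group FR.int_pow_neg FR.m_assoc)
qed simp

lemma conj_conj_prod:
  assumes "set cs \<subseteq> conj_factors G" and k: "k \<in> carrier (FR G)"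
  shows "k \<otimes>\<^bsub>FR G\<^esub> conj_prod G cs \<otimes>\<^bsub>FR G\<^esub> inv\<^bsub>FR G\<^esub> k
    = conj_prod G (map (\<lambda>(h, g, r, e). (k \<otimes>\<^bsub>FR G\<^esub> h, g, r, e)) cs)"
  using assms(1)
proof (induction cs)
  case (Cons c cs)
  obtain h g r e where c: "c = (h, g, r, e)" by (cases c)
  have cancel: "inv\<^bsub>FR G\<^esub> k \<otimes>\<^bsub>FR G\<^esub> (k \<otimes>\<^bsub>FR G\<^esub> x) = x" if "x \<in> carrier (FR G)" for x
    using that k by (simp flip: FR.m_assoc)
  have sub: "set cs \<subseteq> conj_factors G" using Cons.prems by simp
  have "conj_prod G (map (\<lambda>(h, g, r, e). (k \<otimes>\<^bsub>FR G\<^esub> h, g, r, e)) cs)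
      = k \<otimes>\<^bsub>FR G\<^esub> conj_prod G cs \<otimes>\<^bsub>FR G\<^esub> inv\<^bsub>FR G\<^esub> k"
    using Cons by simp
  then show ?case
    using Cons.prems k conj_prod_closed[OF sub]
    by (simp add: c FR.m_assoc FR.inv_mult_group cancel)
qed (use k in simp)

sublocale FRn: conj_inv_pseudonormed_group "FR G" "FR_norm G N"
proof
  show one: "FR_norm G N \<one>\<^bsub>FR G\<^esub> = 0"
  proof (rule antisym)
    show "FR_norm G N \<one>\<^bsub>FR G\<^esub> \<le> 0" using FR_norm_le[of "[]"] by simp
    show "0 \<le> FR_norm G N \<one>\<^bsub>FR G\<^esub>" by (rule FR_norm_greatest) (simp_all add: conj_cost_nonneg)
  qed
  have inv_le: "FR_norm G N (inv\<^bsub>FR G\<^esub> x) \<le> FR_norm G N x" if x: "x \<in> carrier (FR G)" for x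
  proof (rule FR_norm_greatest[OF x])
    fix cs assume cs: "set cs \<subseteq> conj_factors G" "x = conj_prod G cs"
    let ?ds = "rev (map (\<lambda>(h, g, r, e). (h, g, r, - e)) cs)"
    have "set ?ds \<subseteq> conj_factors G" using cs(1) by auto
    then have "FR_norm G N (conj_prod G ?ds) \<le> conj_cost N ?ds" by (rule FR_norm_le)
    also have "conj_cost N ?ds = conj_cost N cs"
      by (simp add: rev_map sum_list_rev o_def case_prod_unfold flip: rev_map)
    finally show "FR_norm G N (inv\<^bsub>FR G\<^esub> x) \<le> conj_cost N cs"
      using cs by (simp add: inv_conj_prod)
  qed
  have conj_le: "FR_norm G N (k \<otimes>\<^bsub>FR G\<^esub> x \<otimes>\<^bsub>FR G\<^esub> inv\<^bsub>FR G\<^esub> k) \<le> FR_norm G N x"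
    if x: "x \<in> carrier (FR G)" and k: "k \<in> carrier (FR G)" for x k
  proof (rule FR_norm_greatest[OF x])
    fix cs assume cs: "set cs \<subseteq> conj_factors G" "x = conj_prod G cs"
    let ?ds = "map (\<lambda>(h, g, r, e). (k \<otimes>\<^bsub>FR G\<^esub> h, g, r, e)) cs"
    have "set ?ds \<subseteq> conj_factors G" using cs(1) k by auto
    then have "FR_norm G N (conj_prod G ?ds) \<le> conj_cost N ?ds" by (rule FR_norm_le)
    also have "conj_cost N ?ds = conj_cost N cs"
      by (simp add: o_def case_prod_unfold)
    finally show "FR_norm G N (k \<otimes>\<^bsub>FR G\<^esub> x \<otimes>\<^bsub>FR G\<^esub> inv\<^bsub>FR G\<^esub> k) \<le> conj_cost N cs"
      using cs k by (simp add: conj_conj_prod)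
  qed
  fix x assume x: "x \<in> carrier (FR G)"
  show "0 \<le> FR_norm G N x" by (rule FR_norm_greatest[OF x]) (rule conj_cost_nonneg)
  show "FR_norm G N (inv\<^bsub>FR G\<^esub> x) = FR_norm G N x"
    using inv_le[of x] inv_le[of "inv\<^bsub>FR G\<^esub> x"] x by simp
  fix y assume y: "y \<in> carrier (FR G)"
  have "FR_norm G N (x \<otimes>\<^bsub>FR G\<^esub> y) - FR_norm G N y \<le> FR_norm G N x"
  proof (rule FR_norm_greatest[OF x])
    fix cs assume cs: "set cs \<subseteq> conj_factors G" "x = conj_prod G cs"
    have "FR_norm G N (x \<otimes>\<^bsub>FR G\<^esub> y) - conj_cost N cs \<le> FR_norm G N y"
    proof (rule FR_norm_greatest[OF y])
      fix ds assume ds: "set ds \<subseteq> conj_factors G" "y = conj_prod G ds"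
      show "FR_norm G N (x \<otimes>\<^bsub>FR G\<^esub> y) - conj_cost N cs \<le> conj_cost N ds"
        using FR_norm_le[of "cs @ ds"] cs ds by (simp add: conj_prod_append)
    qed
    then show "FR_norm G N (x \<otimes>\<^bsub>FR G\<^esub> y) - FR_norm G N y \<le> conj_cost N cs" by simp
  qed
  then show "FR_norm G N (x \<otimes>\<^bsub>FR G\<^esub> y) \<le> FR_norm G N x + FR_norm G N y" by simp
  have "inv\<^bsub>FR G\<^esub> y \<otimes>\<^bsub>FR G\<^esub> (y \<otimes>\<^bsub>FR G\<^esub> x \<otimes>\<^bsub>FR G\<^esub> inv\<^bsub>FR G\<^esub> y) \<otimes>\<^bsub>FR G\<^esub> inv\<^bsub>FR G\<^esub> (inv\<^bsub>FR G\<^esub> y) = x"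
    using x y by (simp add: FR.m_assoc FR.inv_solve_left')
  then show "FR_norm G N (y \<otimes>\<^bsub>FR G\<^esub> x \<otimes>\<^bsub>FR G\<^esub> inv\<^bsub>FR G\<^esub> y) = FR_norm G N x"
    using conj_le[of x y] conj_le[of "y \<otimes>\<^bsub>FR G\<^esub> x \<otimes>\<^bsub>FR G\<^esub> inv\<^bsub>FR G\<^esub> y" "inv\<^bsub>FR G\<^esub> y"] x y by simp
qed

section \<open>The directional asymptotic cone\<close>

abbreviation FZ_maps where "FZ_maps T \<equiv> product_group T (\<lambda>_. FZ G)"

lemma group_FZ_maps: "group (FZ_maps T)"
  by (simp add: group_FZ)

lemma FZ_maps_apply: "\<lbrakk>w \<in> carrier (FZ_maps T); t \<in> T\<rbrakk> \<Longrightarrow> w t \<in> carrier (FZ G)"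
  by (auto dest: PiE_mem)

lemma rescale_closed:
  "\<lbrakk>w \<in> carrier (FZ_maps T); t \<in> T\<rbrakk> \<Longrightarrow> scale_hom G (1 / t) (w t) \<in> carrier (FR G)"
  by (intro scale_hom_closed FZ_closed FZ_maps_apply)

lemma rescale_hom:
  assumes "t \<in> T"
  shows "group_hom (FZ_maps T) (FR G) (\<lambda>w. scale_hom G (1 / t) (w t))"
proof (intro group_homI group_FZ_maps FR.is_group homI)
  fix w assume w: "w \<in> carrier (FZ_maps T)"
  then show "scale_hom G (1 / t) (w t) \<in> carrier (FR G)"
    using assms by (rule rescale_closed)
  fix v assume v: "v \<in> carrier (FZ_maps T)"
  have "w t \<in> carrier (FR G)" "v t \<in> carrier (FR G)"
    using FZ_maps_apply[OF w assms] FZ_maps_apply[OF v assms] by (simp_all add: FZ_closed)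
  then show "scale_hom G (1 / t) ((w \<otimes>\<^bsub>FZ_maps T\<^esub> v) t)
      = scale_hom G (1 / t) (w t) \<otimes>\<^bsub>FR G\<^esub> scale_hom G (1 / t) (v t)"
    using assms scale_hom_hom[of "1 / t"] by (simp add: hom_def)
qed

lemma dir_group_eq: "dir_group G N T = (FZ_maps T)\<lparr>carrier := carrier (dir_group G N T)\<rparr>"
  by (simp add: dir_group_def)

lemma dir_group_mem:
  "w \<in> carrier (dir_group G N T) \<longleftrightarrow> w \<in> carrier (FZ_maps T) \<and>
    cauchy_on T (norm_dist (FR G) (FR_norm G N)) (\<lambda>t. scale_hom G (1 / t) (w t))"
  by (simp add: dir_group_def)

lemma subgroup_dir_group: "subgroup (carrier (dir_group G N T)) (FZ_maps T)"
proof (rule group.subgroupI[OF group_FZ_maps])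
  interpret P: group "FZ_maps T" by (rule group_FZ_maps)
  have hom: "group_hom (FZ_maps T) (FR G) (\<lambda>w. scale_hom G (1 / t) (w t))" if "t \<in> T" for t
    using that by (rule rescale_hom)
  show "carrier (dir_group G N T) \<subseteq> carrier (FZ_maps T)" by (auto simp only: dir_group_mem)
  have "\<one>\<^bsub>FZ_maps T\<^esub> \<in> carrier (dir_group G N T)"
    unfolding dir_group_mem
  proof
    show "cauchy_on T (norm_dist (FR G) (FR_norm G N)) (\<lambda>t. scale_hom G (1 / t) (\<one>\<^bsub>FZ_maps T\<^esub> t))"
      using FRn.cauchy_on_const_one
      by (subst cauchy_on_cong[where g = "\<lambda>_. \<one>\<^bsub>FR G\<^esub>"]) (simp only: group_hom.hom_one[OF hom])
  qed (rule P.one_closed)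
  then show "carrier (dir_group G N T) \<noteq> {}" by blast
  fix w assume w: "w \<in> carrier (dir_group G N T)"
  then have wP: "w \<in> carrier (FZ_maps T)" by (simp only: dir_group_mem)
  show "inv\<^bsub>FZ_maps T\<^esub> w \<in> carrier (dir_group G N T)"
    unfolding dir_group_mem
  proof
    show "inv\<^bsub>FZ_maps T\<^esub> w \<in> carrier (FZ_maps T)" using wP by (rule P.inv_closed)
    have "cauchy_on T (norm_dist (FR G) (FR_norm G N)) (\<lambda>t. inv\<^bsub>FR G\<^esub> scale_hom G (1 / t) (w t))"
      by (rule FRn.cauchy_on_inv) (use w wP rescale_closed in \<open>auto simp only: dir_group_mem\<close>)
    then show "cauchy_on T (norm_dist (FR G) (FR_norm G N))
        (\<lambda>t. scale_hom G (1 / t) ((inv\<^bsub>FZ_maps T\<^esub> w) t))"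
      by (subst cauchy_on_cong) (simp only: group_hom.hom_inv[OF hom wP])
  qed
  fix v assume v: "v \<in> carrier (dir_group G N T)"
  then have vP: "v \<in> carrier (FZ_maps T)" by (simp only: dir_group_mem)
  show "w \<otimes>\<^bsub>FZ_maps T\<^esub> v \<in> carrier (dir_group G N T)"
    unfolding dir_group_mem
  proof
    show "w \<otimes>\<^bsub>FZ_maps T\<^esub> v \<in> carrier (FZ_maps T)" using wP vP by (rule P.m_closed)
    have "cauchy_on T (norm_dist (FR G) (FR_norm G N))
        (\<lambda>t. scale_hom G (1 / t) (w t) \<otimes>\<^bsub>FR G\<^esub> scale_hom G (1 / t) (v t))"
      by (rule FRn.cauchy_on_mult)
         (use w wP v vP rescale_closed in \<open>auto simp only: dir_group_mem\<close>)
    then show "cauchy_on T (norm_dist (FR G) (FR_norm G N))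
        (\<lambda>t. scale_hom G (1 / t) ((w \<otimes>\<^bsub>FZ_maps T\<^esub> v) t))"
      by (subst cauchy_on_cong) (simp only: group_hom.hom_mult[OF hom wP vP])
  qed
qed

lemma group_dir_group: "group (dir_group G N T)"
  by (subst dir_group_eq) (rule subgroup.subgroup_is_group[OF subgroup_dir_group group_FZ_maps])

lemma dir_norm_tendsto:
  assumes "w \<in> carrier (dir_group G N T)" "scaling_set T"
  shows "((\<lambda>t. FR_norm G N (scale_hom G (1 / t) (w t))) \<longlongrightarrow> dir_norm G N T w) (at_top_in T)"
  unfolding dir_norm_def
  by (rule FRn.cauchy_on_norm_converges)
     (use assms rescale_closed in \<open>auto simp only: dir_group_mem\<close>)

lemma dir_norm_pseudonorm:
  assumes T: "scaling_set T"
  shows "conj_inv_pseudonormed_group (dir_group G N T) (dir_norm G N T)"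
proof (rule pseudonorm_limit[where F = "at_top_in T"])
  show "\<forall>\<^sub>F t in at_top_in T. conj_inv_pseudonormed_group (dir_group G N T)
      (\<lambda>w. FR_norm G N (scale_hom G (1 / t) (w t)))"
  proof (rule eventually_at_top_in_mem)
    fix t assume "t \<in> T"
    then interpret group_hom "FZ_maps T" "FR G" "\<lambda>w. scale_hom G (1 / t) (w t)"
      by (rule rescale_hom)
    have hom: "(\<lambda>w. scale_hom G (1 / t) (w t)) \<in> hom (dir_group G N T) (FR G)"
      using homh by (auto simp: hom_def dir_group_mem) (auto simp: dir_group_def)
    show "conj_inv_pseudonormed_group (dir_group G N T)
        (\<lambda>w. FR_norm G N (scale_hom G (1 / t) (w t)))"
      by (rule pseudonorm_pullback[OF group_homI[OF group_dir_group FR.is_group hom]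
            FRn.conj_inv_pseudonormed_group_axioms])
  qed
qed (simp_all add: at_top_in_neq_bot[OF T] group_dir_group dir_norm_tendsto[OF _ T])

lemma eval_maps_hom: "group_hom (FZ_maps T) (product_group T (\<lambda>_. G)) (compose T (eval_hom G))"
proof (intro group_homI group_FZ_maps product_group homI)
  fix w assume w: "w \<in> carrier (FZ_maps T)"
  then show "compose T (eval_hom G) w \<in> carrier (product_group T (\<lambda>_. G))"
    using eval_hom_hom by (auto simp: compose_def hom_def)
  fix v assume v: "v \<in> carrier (FZ_maps T)"
  show "compose T (eval_hom G) (w \<otimes>\<^bsub>FZ_maps T\<^esub> v)
      = compose T (eval_hom G) w \<otimes>\<^bsub>product_group T (\<lambda>_. G)\<^esub> compose T (eval_hom G) v"
    using eval_hom_hom FZ_maps_apply[OF v] FZ_maps_apply[OF w]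
    by (auto simp: compose_def hom_def fun_eq_iff)
qed (rule is_group)

lemma eval_dir_group_hom:
  "group_hom (dir_group G N T) (pre_cone G N T) (compose T (eval_hom G))"
proof -
  have "pre_cone G N T = (product_group T (\<lambda>_. G))
      \<lparr>carrier := compose T (eval_hom G) ` carrier (dir_group G N T)\<rparr>"
    by (simp add: pre_cone_def)
  then show ?thesis
    using group_hom.induced_group_hom[OF eval_maps_hom subgroup_dir_group, of T]
    by (simp flip: dir_group_eq)
qed

lemma carrier_pre_cone: "carrier (pre_cone G N T) = compose T (eval_hom G) ` carrier (dir_group G N T)"
  by (simp add: pre_cone_def)

lemma pre_cone_norm_eq:
  "pre_cone_norm G N T = pushforward_pn (dir_group G N T) (dir_norm G N T) (compose T (eval_hom G))"
  by (simp add: pre_cone_norm_def pushforward_pn_def fun_eq_iff)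

lemma pre_cone_norm_pseudonorm:
  assumes "scaling_set T"
  shows "conj_inv_pseudonormed_group (pre_cone G N T) (pre_cone_norm G N T)"
  unfolding pre_cone_norm_eq
  by (rule pseudonorm_pushforward[OF dir_norm_pseudonorm[OF assms] eval_dir_group_hom])
     (simp add: carrier_pre_cone)

text \<open>By \<open>norm_eval_hom_le_scaled\<close> the left-hand side is below a function of \<open>t\<close> that converges to \<open>\<parallel>w\<parallel>\<close>.\<close>

lemma norm_div_eventually_le:
  assumes T: "scaling_set T" and w: "w \<in> carrier (dir_group G N T)" and c: "dir_norm G N T w < c"
  shows "\<forall>\<^sub>F t in at_top_in T. N (compose T (eval_hom G) w t) / t \<le> c"
proof -
  have "\<forall>\<^sub>F t in at_top_in T. FR_norm G N (scale_hom G (1 / t) (w t)) < c"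
    using order_tendstoD(2)[OF dir_norm_tendsto[OF w T] c] .
  moreover have "\<forall>\<^sub>F t in at_top_in T.
      N (compose T (eval_hom G) w t) / t \<le> FR_norm G N (scale_hom G (1 / t) (w t))"
  proof (rule eventually_at_top_in_mem)
    fix t assume t: "t \<in> T"
    then have "w t \<in> carrier (FZ G)" "0 < t"
      using w T by (auto simp: dir_group_mem scaling_set_def)
    then show "N (compose T (eval_hom G) w t) / t \<le> FR_norm G N (scale_hom G (1 / t) (w t))"
      using t norm_eval_hom_le_scaled by (simp add: compose_def)
  qed
  ultimately show ?thesis by eventually_elim simp
qed

end


section \<open>Ultrafilter limits\<close>

text \<open>By compactness there is an accumulation point, and an ultrafilter converges to each of its accumulation points.\<close>

lemma ultrafilter_bounded_converges:
  fixes f :: "'b \<Rightarrow> real"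
  assumes \<omega>: "\<omega> \<noteq> bot" "\<And>P. eventually P \<omega> \<or> eventually (\<lambda>x. \<not> P x) \<omega>"
    and bounded: "\<forall>\<^sub>F n in \<omega>. \<bar>f n\<bar> \<le> K"
  shows "(f \<longlongrightarrow> Lim \<omega> f) \<omega>"
proof -
  have "\<forall>\<^sub>F x in filtermap f \<omega>. x \<in> {- K..K}"
    using bounded by (auto simp: eventually_filtermap elim!: eventually_mono)
  moreover have "filtermap f \<omega> \<noteq> bot" using \<omega>(1) by (simp add: filtermap_bot_iff)
  ultimately obtain L where L: "inf (nhds L) (filtermap f \<omega>) \<noteq> bot"
    using compact_Icc[of "- K" K] unfolding compact_filter by blast
  have "(f \<longlongrightarrow> L) \<omega>"
  proof (rule topological_tendstoI)
    fix S assume S: "open S" "L \<in> S"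
    show "\<forall>\<^sub>F n in \<omega>. f n \<in> S"
    proof (rule ccontr)
      assume "\<not> (\<forall>\<^sub>F n in \<omega>. f n \<in> S)"
      then have "\<forall>\<^sub>F x in filtermap f \<omega>. x \<notin> S"
        using \<omega>(2)[of "\<lambda>n. f n \<in> S"] by (simp add: eventually_filtermap)
      moreover have "\<forall>\<^sub>F x in nhds L. x \<in> S" using S by (rule eventually_nhds_in_open)
      ultimately have "eventually (\<lambda>_. False) (inf (nhds L) (filtermap f \<omega>))"
        unfolding eventually_inf by blast
      then show False using L by (simp add: trivial_limit_def)
    qed
  qed
  then show ?thesis using tendsto_Lim[OF \<omega>(1)] by blast
qed

text \<open>An ultrafilter that contains a singleton is principal, so a non-principal one avoids every finite set.\<close>

lemma nonprincipal_ultrafilter_le_sequentially: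
  fixes \<omega> :: "nat filter"
  assumes "nonprincipal_ultrafilter \<omega>"
  shows "\<omega> \<le> sequentially"
proof -
  have \<omega>: "\<omega> \<noteq> bot" "\<And>P. eventually P \<omega> \<or> eventually (\<lambda>x. \<not> P x) \<omega>"
      "\<And>x. \<omega> \<noteq> principal {x}"
    using assms by (auto simp: nonprincipal_ultrafilter_def)
  have neq: "\<forall>\<^sub>F n in \<omega>. n \<noteq> m" for m
  proof (rule ccontr)
    assume "\<not> (\<forall>\<^sub>F n in \<omega>. n \<noteq> m)"
    then have m: "\<forall>\<^sub>F n in \<omega>. n = m" using \<omega>(2)[of "\<lambda>n. n = m"] by simp
    have "eventually P \<omega> \<longleftrightarrow> P m" for P
    proof
      assume "eventually P \<omega>"
      then have "\<forall>\<^sub>F n in \<omega>. P m" using m by eventually_elim simp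
      then show "P m" using \<omega>(1) by (simp add: eventually_const)
    next
      assume "P m" then show "eventually P \<omega>" using m by (auto elim: eventually_mono)
    qed
    then have "\<omega> = principal {m}" by (simp add: filter_eq_iff eventually_principal)
    then show False using \<omega>(3) by blast
  qed
  have "\<forall>\<^sub>F n in \<omega>. m \<le> n" for m
  proof -
    have "\<forall>\<^sub>F n in \<omega>. \<forall>k\<in>{..<m}. n \<noteq> k"
      by (rule eventually_ball_finite) (simp_all add: neq)
    then show ?thesis by eventually_elim (use not_le in blast)
  qed
  then show ?thesis
    by (intro filter_leI) (metis (mono_tags, lifting) eventually_mono eventually_sequentially)
qed


section \<open>The ultrafilter cone\<close>

locale ultra_scaled_group = conj_inv_normed_group G N for G (structure) and N +
  fixes d :: "nat \<Rightarrow> real" and \<omega> :: "nat filter"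
  assumes scale_pos: "0 < d n"
    and ultrafilter: "nonprincipal_ultrafilter \<omega>"
begin

abbreviation seqs where "seqs \<equiv> product_group (UNIV :: nat set) (\<lambda>_. G)"
abbreviation bseqs where "bseqs \<equiv> bounded_seq_group G N d"

lemma group_seqs: "group seqs"
  by simp

lemma seq_norm_pseudonorm:
  "conj_inv_pseudonormed_group seqs (\<lambda>g. N (g n) / d n)"
proof -
  have hom: "(\<lambda>g. g n) \<in> hom seqs G" by (rule homI) auto
  show ?thesis
    by (rule pseudonorm_divide[OF pseudonorm_pullback[OF group_homI[OF group_seqs is_group hom]
          pn.conj_inv_pseudonormed_group_axioms] scale_pos])
qed

lemma bseqs_eq: "bseqs = seqs\<lparr>carrier := carrier bseqs\<rparr>"
  by (simp add: bounded_seq_group_def)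

text \<open>Eventual bounds are easier to combine than the limes superior, which takes values in the extended reals.\<close>

lemma bseqs_mem:
  "g \<in> carrier bseqs \<longleftrightarrow>
    g \<in> carrier seqs \<and> (\<exists>K. \<forall>\<^sub>F n in sequentially. N (g n) / d n \<le> K)"
proof -
  have "limsup (\<lambda>n. ereal (N (g n) / d n)) < \<infinity> \<longleftrightarrow>
      (\<exists>K. \<forall>\<^sub>F n in sequentially. N (g n) / d n \<le> K)"
  proof
    assume "limsup (\<lambda>n. ereal (N (g n) / d n)) < \<infinity>"
    then obtain k :: nat where "limsup (\<lambda>n. ereal (N (g n) / d n)) < ereal (real k)"
      using less_PInf_Ex_of_nat by auto
    then have "\<forall>\<^sub>F n in sequentially. ereal (N (g n) / d n) < ereal (real k)"
      by (rule Limsup_lessD)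
    then have "\<forall>\<^sub>F n in sequentially. N (g n) / d n \<le> real k"
      by eventually_elim simp
    then show "\<exists>K. \<forall>\<^sub>F n in sequentially. N (g n) / d n \<le> K" ..
  next
    assume "\<exists>K. \<forall>\<^sub>F n in sequentially. N (g n) / d n \<le> K"
    then obtain K where "\<forall>\<^sub>F n in sequentially. ereal (N (g n) / d n) \<le> ereal K" by auto
    then have "limsup (\<lambda>n. ereal (N (g n) / d n)) \<le> ereal K" by (rule Limsup_bounded)
    also have "\<dots> < \<infinity>" by simp
    finally show "limsup (\<lambda>n. ereal (N (g n) / d n)) < \<infinity>" .
  qed
  then show ?thesis by (simp add: bounded_seq_group_def)
qed

lemma subgroup_bseqs: "subgroup (carrier bseqs) seqs"
proof (rule group.subgroupI[OF group_seqs])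
  note pn_inv = conj_inv_pseudonormed_group.pn_inv[OF seq_norm_pseudonorm]
    and pn_triangle = conj_inv_pseudonormed_group.pn_triangle[OF seq_norm_pseudonorm]
    and pn_one = conj_inv_pseudonormed_group.pn_one[OF seq_norm_pseudonorm]
  show "carrier bseqs \<subseteq> carrier seqs" by (auto simp only: bseqs_mem)
  have "\<one>\<^bsub>seqs\<^esub> \<in> carrier bseqs"
    unfolding bseqs_mem
    by (intro conjI exI[of _ 0] always_eventually allI monoid.one_closed group.is_monoid group_seqs)
       (simp only: pn_one order.refl)
  then show "carrier bseqs \<noteq> {}" by blast
  fix g assume g: "g \<in> carrier bseqs"
  then have gS: "g \<in> carrier seqs" by (simp only: bseqs_mem)
  obtain K where K: "\<forall>\<^sub>F n in sequentially. N (g n) / d n \<le> K" using g by (auto simp only: bseqs_mem)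
  show "inv\<^bsub>seqs\<^esub> g \<in> carrier bseqs"
    unfolding bseqs_mem pn_inv[OF gS] using K group.inv_closed[OF group_seqs gS] by blast
  fix h assume h: "h \<in> carrier bseqs"
  then have hS: "h \<in> carrier seqs" by (simp only: bseqs_mem)
  obtain K' where K': "\<forall>\<^sub>F n in sequentially. N (h n) / d n \<le> K'" using h by (auto simp only: bseqs_mem)
  have "\<forall>\<^sub>F n in sequentially. N ((g \<otimes>\<^bsub>seqs\<^esub> h) n) / d n \<le> K + K'"
    using K K'
  proof eventually_elim
    case (elim n)
    show ?case using pn_triangle[OF gS hS, of n] elim by linarith
  qed
  then show "g \<otimes>\<^bsub>seqs\<^esub> h \<in> carrier bseqs"
    unfolding bseqs_mem using monoid.m_closed[OF group.is_monoid[OF group_seqs] gS hS] by blast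
qed

lemma group_bseqs: "group bseqs"
  by (subst bseqs_eq) (rule subgroup.subgroup_is_group[OF subgroup_bseqs group_seqs])

abbreviation seq_norm where "seq_norm g \<equiv> Lim \<omega> (\<lambda>n. N (g n) / d n)"

lemma \<omega>_neq_bot: "\<omega> \<noteq> bot"
  using ultrafilter by (simp add: nonprincipal_ultrafilter_def)

lemma seq_norm_tendsto:
  assumes g: "g \<in> carrier bseqs"
  shows "((\<lambda>n. N (g n) / d n) \<longlongrightarrow> seq_norm g) \<omega>"
proof -
  obtain K where K: "\<forall>\<^sub>F n in sequentially. N (g n) / d n \<le> K" and gS: "g \<in> carrier seqs"
    using g by (auto simp only: bseqs_mem)
  have "\<forall>\<^sub>F n in sequentially. \<bar>N (g n) / d n\<bar> \<le> K"
    using K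
  proof eventually_elim
    case (elim n)
    have "0 \<le> N (g n) / d n"
      using conj_inv_pseudonormed_group.pn_nonneg[OF seq_norm_pseudonorm gS] .
    then show ?case using elim by simp
  qed
  then have "\<forall>\<^sub>F n in \<omega>. \<bar>N (g n) / d n\<bar> \<le> K"
    by (rule filter_leD[OF nonprincipal_ultrafilter_le_sequentially[OF ultrafilter]])
  then show ?thesis
    using ultrafilter ultrafilter_bounded_converges[of \<omega>]
    by (auto simp: nonprincipal_ultrafilter_def)
qed

sublocale bs: conj_inv_pseudonormed_group bseqs seq_norm
proof (rule pseudonorm_limit[where F = \<omega> and \<nu> = "\<lambda>n g. N (g n) / d n"])
  show "\<forall>\<^sub>F n in \<omega>. conj_inv_pseudonormed_group bseqs (\<lambda>g. N (g n) / d n)"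
  proof (intro always_eventually allI)
    fix n
    have "group_hom bseqs seqs (\<lambda>g. g)"
      by (intro group_homI group_bseqs group_seqs homI)
         (auto simp: bseqs_mem, simp add: bounded_seq_group_def)
    from pseudonorm_pullback[OF this seq_norm_pseudonorm]
    show "conj_inv_pseudonormed_group bseqs (\<lambda>g. N (g n) / d n)" .
  qed
qed (simp_all add: \<omega>_neq_bot group_bseqs seq_norm_tendsto)

lemma ultra_cone_rel_eq: "ultra_cone_rel G N d \<omega> = bs.null_rel"
proof -
  have "((\<lambda>n. N (inv g n \<otimes> h n) / d n) \<longlongrightarrow> 0) \<omega> \<longleftrightarrow> seq_norm (inv\<^bsub>bseqs\<^esub> g \<otimes>\<^bsub>bseqs\<^esub> h) = 0"
    if g: "g \<in> carrier bseqs" and h: "h \<in> carrier bseqs" for g h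
  proof -
    have "inv\<^bsub>bseqs\<^esub> g = inv\<^bsub>seqs\<^esub> g"
      by (subst bseqs_eq) (rule group.m_inv_consistent[OF group_seqs subgroup_bseqs g])
    then have eq: "(inv\<^bsub>bseqs\<^esub> g \<otimes>\<^bsub>bseqs\<^esub> h) n = inv g n \<otimes> h n" for n
      using g by (simp add: bseqs_mem is_group) (simp add: bounded_seq_group_def)
    have lim: "((\<lambda>n. N (inv g n \<otimes> h n) / d n) \<longlongrightarrow> seq_norm (inv\<^bsub>bseqs\<^esub> g \<otimes>\<^bsub>bseqs\<^esub> h)) \<omega>"
      using seq_norm_tendsto[OF bs.m_closed[OF bs.inv_closed[OF g] h]] unfolding eq .
    show ?thesis
    proof
      assume "((\<lambda>n. N (inv g n \<otimes> h n) / d n) \<longlongrightarrow> 0) \<omega>"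
      then show "seq_norm (inv\<^bsub>bseqs\<^esub> g \<otimes>\<^bsub>bseqs\<^esub> h) = 0"
        by (rule tendsto_unique[OF \<omega>_neq_bot lim])
    next
      assume "seq_norm (inv\<^bsub>bseqs\<^esub> g \<otimes>\<^bsub>bseqs\<^esub> h) = 0"
      then show "((\<lambda>n. N (inv g n \<otimes> h n) / d n) \<longlongrightarrow> 0) \<omega>" using lim by (simp only:)
    qed
  qed
  then show ?thesis by (auto simp: ultra_cone_rel_def bs.null_rel_def)
qed

lemma ultra_cone_eq: "ultra_cone G N d \<omega> = quotient_monoid bseqs bs.null_rel"
  by (simp add: ultra_cone_def ultra_cone_rel_eq)

lemma group_ultra_cone: "group (ultra_cone G N d \<omega>)"
  unfolding ultra_cone_eq by (rule bs.group_quotient_null_rel)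

lemma ultra_cone_class_hom: "ultra_cone_class G N d \<omega> \<in> hom bseqs (ultra_cone G N d \<omega>)"
  using monoid_congruence.class_hom[OF bs.null_rel_congruence]
  by (simp add: ultra_cone_eq ultra_cone_class_def[abs_def] ultra_cone_rel_eq)

lemma ultra_cone_norm_class:
  "g \<in> carrier bseqs \<Longrightarrow> ultra_cone_norm G N d \<omega> (ultra_cone_class G N d \<omega> g) = seq_norm g"
  by (simp add: ultra_cone_norm_def ultra_cone_class_def ultra_cone_rel_eq bs.pn_image_class)

lemma ultra_cone_class_eq_one:
  assumes g: "g \<in> carrier bseqs" and "seq_norm g = 0"
  shows "ultra_cone_class G N d \<omega> g = \<one>\<^bsub>ultra_cone G N d \<omega>\<^esub>"
proof -
  interpret C: monoid_congruence bseqs bs.null_rel by (rule bs.null_rel_congruence)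
  have "(\<one>\<^bsub>bseqs\<^esub>, g) \<in> bs.null_rel" using assms by (simp add: bs.null_rel_def)
  then have "C.cls \<one>\<^bsub>bseqs\<^esub> = C.cls g" using g by (simp add: C.class_eq_iff)
  then show ?thesis
    by (simp add: ultra_cone_class_def ultra_cone_rel_eq ultra_cone_eq C.one_quotient_monoid)
qed

end


section \<open>Comparing the cones\<close>

locale cone_comparison = ultra_scaled_group G N d \<omega>
  for G (structure) and N d \<omega> +
  fixes T :: "real set"
  assumes scaling_set: "scaling_set T" and scaling_sequence: "scaling_sequence T d"
begin

abbreviation precone where "precone \<equiv> pre_cone G N T"

sublocale pc: conj_inv_pseudonormed_group precone "pre_cone_norm G N T"
  by (rule pre_cone_norm_pseudonorm[OF scaling_set])

lemma scale_in_T: "d n \<in> T"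
  using scaling_sequence by (auto simp: scaling_sequence_def)

lemma scale_tendsto: "filterlim d (at_top_in T) sequentially"
  using scaling_sequence scale_in_T
  by (simp add: scaling_sequence_def at_top_in_def filterlim_inf filterlim_principal)

lemma along_scale_closed:
  assumes g: "g \<in> carrier precone" shows "g \<circ> d \<in> carrier bseqs"
proof -
  obtain w where w: "w \<in> carrier (dir_group G N T)" "g = compose T (eval_hom G) w"
    using g by (auto simp: carrier_pre_cone)
  have "\<forall>\<^sub>F t in at_top_in T. N (g t) / t \<le> dir_norm G N T w + 1"
    unfolding w(2) by (rule norm_div_eventually_le[OF scaling_set w(1)]) simp
  then have "\<forall>\<^sub>F n in sequentially. N (g (d n)) / d n \<le> dir_norm G N T w + 1"
    using scale_tendsto unfolding filterlim_iff by blast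
  moreover have "g \<in> carrier (product_group T (\<lambda>_. G))"
    unfolding w(2) using group_hom.hom_closed[OF eval_maps_hom, of w T] w(1) dir_group_mem by blast
  then have "g \<circ> d \<in> carrier seqs" using scale_in_T by auto
  ultimately show ?thesis unfolding bseqs_mem by auto
qed

lemma along_scale_hom: "(\<lambda>g. g \<circ> d) \<in> hom precone bseqs"
  by (rule homI)
     (simp add: along_scale_closed,
      simp add: pre_cone_def bounded_seq_group_def fun_eq_iff scale_in_T)

text \<open>Every \<open>w\<close> above \<open>g\<close> bounds \<open>\<parallel>g(t)\<parallel> / t\<close> eventually by \<open>\<parallel>w\<parallel> + \<epsilon>\<close>. The limit along \<open>\<omega>\<close> inherits
  this bound, as \<open>d\<close> runs through \<open>T\<close> to infinity.\<close>

lemma seq_norm_along_scale_le: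
  assumes g: "g \<in> carrier precone"
  shows "seq_norm (g \<circ> d) \<le> pre_cone_norm G N T g"
  unfolding pre_cone_norm_eq
proof (rule pushforward_pn_greatest)
  show "g \<in> compose T (eval_hom G) ` carrier (dir_group G N T)"
    using g by (simp add: carrier_pre_cone)
  fix w assume w: "w \<in> carrier (dir_group G N T)" "compose T (eval_hom G) w = g"
  show "seq_norm (g \<circ> d) \<le> dir_norm G N T w"
  proof (rule field_le_epsilon)
    fix \<epsilon> :: real assume "0 < \<epsilon>"
    then have "\<forall>\<^sub>F t in at_top_in T. N (g t) / t \<le> dir_norm G N T w + \<epsilon>"
      using norm_div_eventually_le[OF scaling_set w(1)] w(2) by simp
    then have "\<forall>\<^sub>F n in sequentially. N ((g \<circ> d) n) / d n \<le> dir_norm G N T w + \<epsilon>"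
      using scale_tendsto unfolding filterlim_iff o_def by blast
    then have "\<forall>\<^sub>F n in \<omega>. N ((g \<circ> d) n) / d n \<le> dir_norm G N T w + \<epsilon>"
      by (rule filter_leD[OF nonprincipal_ultrafilter_le_sequentially[OF ultrafilter]])
    then show "seq_norm (g \<circ> d) \<le> dir_norm G N T w + \<epsilon>"
      by (rule tendsto_upperbound[OF seq_norm_tendsto[OF along_scale_closed[OF g]] _ \<omega>_neq_bot])
  qed
qed

lemma pre_cone_null_eq: "pre_cone_null G N T = pc.null_set"
  by (simp add: pre_cone_null_def pc.null_set_def)

lemma dir_cone_norm_class:
  "g \<in> carrier precone \<Longrightarrow> dir_cone_norm G N T (dir_cone_class G N T g) = pre_cone_norm G N T g"
  by (simp add: dir_cone_norm_def dir_cone_class_def pre_cone_null_eq pc.pn_image_coset)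

lemma group_dir_cone: "group (dir_cone G N T)"
  unfolding dir_cone_def pre_cone_null_eq by (rule normal.factorgroup_is_group[OF pc.normal_null_set])

lemma dir_cone_cases:
  assumes "X \<in> carrier (dir_cone G N T)"
  obtains g where "g \<in> carrier precone" "X = dir_cone_class G N T g"
  using assms by (auto simp: dir_cone_def carrier_FactGroup dir_cone_class_def)

lemma ex_comparison_map:
  "\<exists>\<rho>. group_hom (dir_cone G N T) (ultra_cone G N d \<omega>) \<rho> \<and>
    (\<forall>g\<in>carrier precone. \<rho> (dir_cone_class G N T g) = ultra_cone_class G N d \<omega> (g \<circ> d))"
proof -
  define f where "f g = ultra_cone_class G N d \<omega> (g \<circ> d)" for g
  have "f \<in> hom precone (ultra_cone G N d \<omega>)"
    using Group.hom_compose[OF along_scale_hom ultra_cone_class_hom] by (simp add: f_def[abs_def] o_def)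
  then interpret f: group_hom precone "ultra_cone G N d \<omega>" f
    by (intro group_homI pc.is_group group_ultra_cone)
  have "pc.null_set \<subseteq> kernel precone (ultra_cone G N d \<omega>) f"
  proof
    fix g assume g: "g \<in> pc.null_set"
    then have gp: "g \<in> carrier precone" by (simp add: pc.null_set_def)
    have "seq_norm (g \<circ> d) \<le> 0"
      using seq_norm_along_scale_le[OF gp] g by (simp add: pc.null_set_def)
    then have "seq_norm (g \<circ> d) = 0"
      using bs.pn_nonneg[OF along_scale_closed[OF gp]] by simp
    then show "g \<in> kernel precone (ultra_cone G N d \<omega>) f"
      using ultra_cone_class_eq_one[OF along_scale_closed[OF gp]] gp by (simp add: kernel_def f_def)
  qed
  from f.FactGroup_universal_kernel[OF pc.normal_null_set this]
  obtain \<rho> where "\<rho> \<in> hom (precone Mod pc.null_set) (ultra_cone G N d \<omega>)"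
    "\<And>g. g \<in> carrier precone \<Longrightarrow> \<rho> (pc.null_set #>\<^bsub>precone\<^esub> g) = f g"
    by blast
  then show ?thesis
    by (intro exI[of _ \<rho>] conjI ballI group_homI group_dir_cone group_ultra_cone)
       (simp_all add: dir_cone_def dir_cone_class_def pre_cone_null_eq f_def)
qed

text \<open>As the map is a homomorphism, only the norm of the image of \<open>X\<^sup>-\<^sup>1 Y\<close> has to be compared with
  that of \<open>X\<^sup>-\<^sup>1 Y\<close>.\<close>

lemma comparison_map_lipschitz:
  assumes "group_hom (dir_cone G N T) (ultra_cone G N d \<omega>) \<rho>"
    and \<rho>: "\<And>g. g \<in> carrier precone \<Longrightarrow> \<rho> (dir_cone_class G N T g) = ultra_cone_class G N d \<omega> (g \<circ> d)"
  shows "lipschitz_map 1 (dir_cone G N T) (dir_cone_norm G N T)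
    (ultra_cone G N d \<omega>) (ultra_cone_norm G N d \<omega>) \<rho>"
  unfolding lipschitz_map_def
proof (intro ballI)
  interpret \<rho>: group_hom "dir_cone G N T" "ultra_cone G N d \<omega>" \<rho> by fact
  fix X Y assume XY: "X \<in> carrier (dir_cone G N T)" "Y \<in> carrier (dir_cone G N T)"
  then have "inv\<^bsub>dir_cone G N T\<^esub> X \<otimes>\<^bsub>dir_cone G N T\<^esub> Y \<in> carrier (dir_cone G N T)" by simp
  then obtain k where k: "k \<in> carrier precone"
      "inv\<^bsub>dir_cone G N T\<^esub> X \<otimes>\<^bsub>dir_cone G N T\<^esub> Y = dir_cone_class G N T k"
    by (rule dir_cone_cases)
  have "inv\<^bsub>ultra_cone G N d \<omega>\<^esub> \<rho> X \<otimes>\<^bsub>ultra_cone G N d \<omega>\<^esub> \<rho> Y = ultra_cone_class G N d \<omega> (k \<circ> d)"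
    using XY k \<rho> by (simp flip: \<rho>.hom_inv \<rho>.hom_mult)
  then have "norm_dist (ultra_cone G N d \<omega>) (ultra_cone_norm G N d \<omega>) (\<rho> X) (\<rho> Y) = seq_norm (k \<circ> d)"
    by (simp only: norm_dist_def ultra_cone_norm_class[OF along_scale_closed[OF k(1)]])
  also have "\<dots> \<le> pre_cone_norm G N T k" by (rule seq_norm_along_scale_le[OF k(1)])
  also have "\<dots> = 1 * norm_dist (dir_cone G N T) (dir_cone_norm G N T) X Y"
    by (simp add: norm_dist_def k dir_cone_norm_class)
  finally show "norm_dist (ultra_cone G N d \<omega>) (ultra_cone_norm G N d \<omega>) (\<rho> X) (\<rho> Y)
    \<le> 1 * norm_dist (dir_cone G N T) (dir_cone_norm G N T) X Y" .
qed

end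

theorem proposition9p2:
  fixes G :: "('a, 'm) monoid_scheme" and N :: "'a \<Rightarrow> real"
    and T :: "real set" and d :: "nat \<Rightarrow> real" and \<omega> :: "nat filter"
  assumes "conj_inv_normed_group G N"
    and "scaling_set T"
    and "scaling_sequence T d"
    and "nonprincipal_ultrafilter \<omega>"
  shows "\<exists>\<rho>. group_hom (dir_cone G N T) (ultra_cone G N d \<omega>) \<rho> \<and>
    (\<forall>g\<in>carrier (pre_cone G N T).
      g \<circ> d \<in> carrier (bounded_seq_group G N d) \<and>
      \<rho> (dir_cone_class G N T g) = ultra_cone_class G N d \<omega> (g \<circ> d)) \<and>
    lipschitz_map 1 (dir_cone G N T) (dir_cone_norm G N T)
      (ultra_cone G N d \<omega>) (ultra_cone_norm G N d \<omega>) \<rho>"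
proof -
  interpret conj_inv_normed_group G N by fact
  interpret cone_comparison G N d \<omega> T
  proof
    show "0 < d n" for n
      using assms(2,3) by (auto simp: scaling_set_def scaling_sequence_def)
  qed fact+
  obtain \<rho> where \<rho>: "group_hom (dir_cone G N T) (ultra_cone G N d \<omega>) \<rho>"
    "\<And>g. g \<in> carrier precone \<Longrightarrow> \<rho> (dir_cone_class G N T g) = ultra_cone_class G N d \<omega> (g \<circ> d)"
    using ex_comparison_map by blast
  then show ?thesis
    using along_scale_closed comparison_map_lipschitz[OF \<rho>] by blast
qed

end
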